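(* There is a universal constant $C>0$ such that for every $p_0\in(0,1)$ and every sufficiently small $\epsilon>0$ there is $\delta>0$ such that for every initial data $\alpha(0)\in h^1$ satisfying $\|\alpha(0)-A(p_0)\|_{h^1}\le\delta$, the corresponding unique solution $\alpha(t)\in C(\mathbb{R}_+,h^1)$ of the conformal flow system $$i(n+1)\frac{d\alpha_n}{dt}=\sum_{j=0}^{\infty}\sum_{k=0}^{n+j}S_{njk,n+j-k}\,\bar\alpha_j\alpha_k\alpha_{n+j-k},\qquad n\in\mathbb{N},$$ satisfies, for some continuous function $t\mapsto p(t)\in[0,p_0]$ and all $t\ge 0$, $$\mathrm{dist}_{h^{1/2}}\left(\alpha(t),\mathcal{A}(p(t))\right)\le\epsilon$$ and $$\mathrm{dist}_{h^1}\left(\alpha(t),\mathcal{A}(p(t))\right)\le C\left(\epsilon+(p_0-p(t))^{1/2}\right).$$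
   Context: $\mathbb{N}=\{0,1,2,\dots\}$; $S_{njk,n+j-k}=\min(n,j,k,n+j-k)+1$; for $s>0$, $h^s$ is the space of complex sequences with finite norm $\|\alpha\|_{h^s}^2=\sum_{n\ge0}(n+1)^{2s}|\alpha_n|^2$. For every $\alpha(0)\in h^1$ the system has a unique global solution in $C(\mathbb{R},h^1)$. For $p\in[0,1)$ the ground state is $A_n(p)=(1-p^2)p^n$ (with $0^0=1$), and its orbit is $\mathcal{A}(p)=\{(e^{i\theta+i\mu n}A_n(p))_{n\in\mathbb{N}}:(\theta,\mu)\in\mathbb{S}^1\times\mathbb{S}^1\}$, $\mathbb{S}^1=\mathbb{R}/2\pi\mathbb{Z}$. For a norm $X$, $\mathrm{dist}_X(\alpha,\mathcal{A}(p))=\inf_{\theta,\mu\in\mathbb{S}^1}\|\alpha-(e^{i\theta+i\mu n}A_n(p))_n\|_X$. *)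

theory Defs
  imports Complex_Main
begin

definition hs_space :: "real \<Rightarrow> (nat \<Rightarrow> complex) set" where
  "hs_space s = {a. summable (\<lambda>n. (real n + 1) powr (2 * s) * (cmod (a n))\<^sup>2)}"

(* Meaningful only on hs_space s: suminf has no useful value on a divergent series. *)
definition hs_norm :: "real \<Rightarrow> (nat \<Rightarrow> complex) \<Rightarrow> real" where
  "hs_norm s a = sqrt (\<Sum>n. (real n + 1) powr (2 * s) * (cmod (a n))\<^sup>2)"

definition hs_dist :: "real \<Rightarrow> (nat \<Rightarrow> complex) \<Rightarrow> (nat \<Rightarrow> complex) set \<Rightarrow> real" where
  "hs_dist s a B = (INF b\<in>B. hs_norm s (\<lambda>n. a n - b n))"

definition interaction_coeff :: "nat \<Rightarrow> nat \<Rightarrow> nat \<Rightarrow> nat \<Rightarrow> nat" where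
  "interaction_coeff n j k m = Min {n, j, k, m} + 1"

(* The subtraction n + j - k never truncates, since k ranges over {0..n + j}.
   The series in j converges absolutely for a in hs_space 1, because such a sequence
   is absolutely summable and the coefficient is at most n + 1. *)
definition conformal_rhs :: "(nat \<Rightarrow> complex) \<Rightarrow> nat \<Rightarrow> complex" where
  "conformal_rhs a n =
     (\<Sum>j. \<Sum>k=0..n + j. of_nat (interaction_coeff n j k (n + j - k))
                          * cnj (a j) * a k * a (n + j - k))"

(* Solutions in C([0,\<infinity>), h^1) with initial value a. Time derivatives are taken
   component by component, and are one-sided at time 0. *)
definition conformal_flow_solution :: "(nat \<Rightarrow> complex) \<Rightarrow> (real \<Rightarrow> nat \<Rightarrow> complex) \<Rightarrow> bool" where
  "conformal_flow_solution a \<alpha> \<longleftrightarrow>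
     \<alpha> 0 = a \<and>
     (\<forall>t\<ge>0. \<alpha> t \<in> hs_space 1) \<and>
     (\<forall>t\<ge>0. ((\<lambda>s. hs_norm 1 (\<lambda>n. \<alpha> s n - \<alpha> t n)) \<longlongrightarrow> 0) (at t within {0..})) \<and>
     (\<forall>t\<ge>0. \<forall>n. \<exists>v. ((\<lambda>s. \<alpha> s n) has_vector_derivative v) (at t within {0..}) \<and>
                     \<i> * of_nat (n + 1) * v = conformal_rhs (\<alpha> t) n)"

definition ground_state :: "real \<Rightarrow> nat \<Rightarrow> complex" where
  "ground_state p n = of_real ((1 - p\<^sup>2) * p ^ n)"

(* The angles range over the reals instead of the circle: the parametrization is
   2 pi-periodic in each of them, so the set is the same. *)
definition ground_state_orbit :: "real \<Rightarrow> (nat \<Rightarrow> complex) set" where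
  "ground_state_orbit p =
     {(\<lambda>n. exp (\<i> * of_real \<theta> + \<i> * of_real \<mu> * of_nat n) * ground_state p n) | \<theta> \<mu> :: real. True}"

end

theory Submission
  imports Defs
    "HOL-Analysis.Infinite_Sum"
    "HOL-Analysis.L2_Norm"
    "HOL-Analysis.Equivalence_Lebesgue_Henstock_Integration"
    "HOL-Analysis.Complex_Transcendental"
begin

text \<open>
  The quantities \<open>Q = \<Sum>(n + 1) |\<alpha>\<^sub>n|\<^sup>2\<close>, \<open>E = \<Sum>(n + 1)\<^sup>2 |\<alpha>\<^sub>n|\<^sup>2\<close> and
  \<open>Z = \<Sum>(n + 1) (n + 2) cnj \<alpha>\<^sub>n\<^sub>+\<^sub>1 \<alpha>\<^sub>n\<close> are conserved, and for real \<open>p\<close>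
  \<open>(1 + p\<^sup>2) E - (1 - p\<^sup>2) Q - 2 p Re Z = \<Sum>(n + 1) (n + 2) |\<alpha>\<^sub>n\<^sub>+\<^sub>1 - p \<alpha>\<^sub>n|\<^sup>2\<close>.
  The right-hand side vanishes exactly on multiples of the ground state and controls the
  squared \<open>h\<^sup>1\<close> distance to them; the conservation of \<open>Q\<close> fixes the modulus of the multiple.
  Hence the orbit of \<open>A(p\<^sub>0)\<close> under phase rotations is itself stable in \<open>h\<^sup>1\<close>, with a deviation
  linear in the initial one, and the theorem holds with the constant choice \<open>p(t) = p\<^sub>0\<close>.
\<close>

section \<open>Resonant quartic sums\<close>

text \<open>Tonelli for three factors, from the inside out; nonnegativity turns convergence of the
  iterated sums into summability on the product.\<close>

lemma has_sum_product3:
  fixes f g h :: "'a \<Rightarrow> real"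
  assumes "(f has_sum F) A" "(g has_sum G) A" "(h has_sum H) A"
    and "\<And>x. f x \<ge> 0" "\<And>x. g x \<ge> 0" "\<And>x. h x \<ge> 0"
  shows "((\<lambda>(x, y, z). f x * g y * h z) has_sum (F * G * H)) (A \<times> A \<times> A)"
proof -
  have sm: "((\<lambda>(y, z). c * g y * h z) has_sum (c * G * H)) (A \<times> A)" if "c \<ge> 0" for c :: real
  proof (rule has_sum_SigmaI)
    show "((\<lambda>z. (case (y, z) of (y, z) \<Rightarrow> c * g y * h z)) has_sum (c * g y * H)) A" for y
      using has_sum_cmult_right[OF assms(3)] by auto
    show "((\<lambda>y. c * g y * H) has_sum (c * G * H)) A"
      by (intro has_sum_cmult_left has_sum_cmult_right assms)
    then have "(\<lambda>y. c * g y * H) summable_on A" by (rule has_sum_imp_summable)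
    then show "(\<lambda>(y, z). c * g y * h z) summable_on A \<times> A"
      using has_sum_cmult_right[OF assms(3)] assms(4-) that
      by (intro summable_on_SigmaI[where g = "\<lambda>y. c * g y * H"]) auto
  qed
  show ?thesis
  proof (rule has_sum_SigmaI)
    show "((\<lambda>w. (case (x, w) of (x, y, z) \<Rightarrow> f x * g y * h z)) has_sum (f x * G * H)) (A \<times> A)" for x
      using sm[of "f x"] assms(4) by auto
    show *: "((\<lambda>x. f x * G * H) has_sum (F * G * H)) A"
      by (intro has_sum_cmult_left assms)
    then have "(\<lambda>x. f x * G * H) summable_on A" by (rule has_sum_imp_summable)
    then show "(\<lambda>(x, y, z). f x * g y * h z) summable_on A \<times> A \<times> A"
      using sm assms(4-)
      by (intro summable_on_SigmaI[where g = "\<lambda>x. f x * G * H"]) auto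
  qed
qed

section \<open>Pairings with the right-hand side as sums over resonances\<close>

text \<open>A free fourth index in place of \<open>n + j - k\<close> avoids subtraction and makes
  the index symmetries bijections of one set.\<close>

definition resonant :: "(nat \<times> nat \<times> nat \<times> nat) set" where
  "resonant = {(n, j, k, m). n + j = k + m}"

text \<open>The summand in the pairing of a test sequence \<open>u\<close> with
  \<open>conformal_rhs a\<close>. The time derivatives of the conserved quantities are built from
  imaginary parts of such pairings.\<close>

definition quartic :: "(nat \<Rightarrow> complex) \<Rightarrow> (nat \<Rightarrow> complex) \<Rightarrow> nat \<times> nat \<times> nat \<times> nat \<Rightarrow> complex" where
  "quartic u a = (\<lambda>(n, j, k, m).
     u n * (of_nat (interaction_coeff n j k m) * cnj (a j) * a k * a m))"

lemma resonant_eq_Sigma: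
  "resonant = Sigma UNIV (\<lambda>n. Sigma UNIV (\<lambda>j. {(k, m). n + j = k + m}))"
  by (auto simp: resonant_def)

lemma bij_betw_resonant_fibre:
  "bij_betw (\<lambda>k. (k, n - k)) {0..n} {(k, m). n = k + (m :: nat)}"
  by (rule bij_betwI[where g = fst]) auto

lemma finite_resonant_fibre: "finite {(k, m). n = k + (m :: nat)}"
  using bij_betw_finite[OF bij_betw_resonant_fibre] by simp

text \<open>The coefficient is at most \<open>k + 1\<close> and is charged to \<open>a k\<close>;
  Young's inequality then separates \<open>u n\<close> from the weighted \<open>a k\<close>. The
  explicit bound later provides a dominating constant uniform in time.\<close>

lemma quartic_abs_summable:
  assumes U: "((\<lambda>n. (cmod (u n))\<^sup>2) has_sum U) UNIV"
    and E: "((\<lambda>n. ((real n + 1) * cmod (a n))\<^sup>2) has_sum E) UNIV"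
    and L: "((\<lambda>n. cmod (a n)) has_sum L) UNIV"
  shows "quartic u a abs_summable_on resonant"
    and "(\<Sum>\<^sub>\<infinity>x\<in>resonant. norm (quartic u a x)) \<le> (U + E) * L\<^sup>2"
proof -
  define T1 where "T1 = (\<lambda>(n::nat, j, m). (cmod (u n))\<^sup>2 * cmod (a j) * cmod (a m))"
  define T2 where "T2 = (\<lambda>(k::nat, j, m). ((real k + 1) * cmod (a k))\<^sup>2 * cmod (a j) * cmod (a m))"
  define p1 :: "nat \<times> nat \<times> nat \<times> nat \<Rightarrow> nat \<times> nat \<times> nat" where "p1 = (\<lambda>(n, j, k, m). (n, j, m))"
  define p2 :: "nat \<times> nat \<times> nat \<times> nat \<Rightarrow> nat \<times> nat \<times> nat" where "p2 = (\<lambda>(n, j, k, m). (k, j, m))"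
  have T1: "(T1 has_sum (U * L * L)) UNIV"
    using has_sum_product3[OF U L L] by (simp add: T1_def)
  have T2: "(T2 has_sum (E * L * L)) UNIV"
    using has_sum_product3[OF E L L] by (simp add: T2_def)
  have inj: "inj_on p1 resonant" "inj_on p2 resonant"
    by (auto simp: inj_on_def p1_def p2_def resonant_def)
  have S1: "T1 summable_on p1 ` resonant" and S2: "T2 summable_on p2 ` resonant"
    using T1 T2 has_sum_imp_summable summable_on_subset_banach subset_UNIV by metis+
  then have R: "(T1 \<circ> p1) summable_on resonant" "(T2 \<circ> p2) summable_on resonant"
    using summable_on_reindex inj by blast+
  \<comment> \<open>On the resonant set the index \<open>k\<close> (or \<open>n\<close>) is determined by the other three, so a product of
    one square-summable weight and two summable sequences dominates.\<close>
  have le: "norm (quartic u a x) \<le> (T1 \<circ> p1) x + (T2 \<circ> p2) x" for x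
  proof (cases x)
    case (fields n j k m)
    define A where "A = cmod (a j) * cmod (a m)"
    have A: "A \<ge> 0" by (simp add: A_def)
    define y where "y = (real k + 1) * cmod (a k)"
    have "real (interaction_coeff n j k m) \<le> real k + 1"
      by (auto simp: interaction_coeff_def)
    then have "real (interaction_coeff n j k m) * cmod (a k) \<le> y"
      unfolding y_def by (intro mult_right_mono) auto
    then have "cmod (u n) * (real (interaction_coeff n j k m) * cmod (a k)) \<le> cmod (u n) * y"
      by (intro mult_left_mono) auto
    also have "\<dots> \<le> (cmod (u n))\<^sup>2 + y\<^sup>2"
    proof -
      have "0 \<le> cmod (u n) * y" by (simp add: y_def)
      then show ?thesis using sum_squares_bound[of "cmod (u n)" y] by linarith
    qed
    finally have "cmod (u n) * (real (interaction_coeff n j k m) * cmod (a k)) * A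
        \<le> ((cmod (u n))\<^sup>2 + y\<^sup>2) * A"
      using A by (intro mult_right_mono) auto
    then show ?thesis
      by (simp add: fields quartic_def norm_mult T1_def T2_def p1_def p2_def A_def y_def algebra_simps)
  qed
  show *: "quartic u a abs_summable_on resonant"
    using abs_summable_on_comparison_test'[OF summable_on_add[OF R] le] .
  have "(\<Sum>\<^sub>\<infinity>x\<in>resonant. norm (quartic u a x))
      \<le> (\<Sum>\<^sub>\<infinity>x\<in>resonant. (T1 \<circ> p1) x + (T2 \<circ> p2) x)"
    by (intro infsum_mono * summable_on_add R le)
  also have "\<dots> = infsum T1 (p1 ` resonant) + infsum T2 (p2 ` resonant)"
    by (subst infsum_add[OF R]) (simp add: infsum_reindex inj)
  also have "\<dots> \<le> infsum T1 UNIV + infsum T2 UNIV"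
    using S1 S2 T1 T2 has_sum_imp_summable
    by (intro add_mono infsum_mono2) (auto simp: T1_def T2_def)
  also have "\<dots> = (U + E) * L\<^sup>2"
    using T1 T2 by (simp add: infsumI power2_eq_square algebra_simps)
  finally show "(\<Sum>\<^sub>\<infinity>x\<in>resonant. norm (quartic u a x)) \<le> (U + E) * L\<^sup>2" .
qed

text \<open>Fubini on \<open>resonant\<close>, read as a nested Sigma: absolute summability
  identifies the unordered sum with the iterated series that defines
  \<open>conformal_rhs\<close>.\<close>

lemma conformal_rhs_sums:
  assumes E: "((\<lambda>n. ((real n + 1) * cmod (a n))\<^sup>2) has_sum E) UNIV"
    and L: "((\<lambda>n. cmod (a n)) has_sum L) UNIV"
    and U: "((\<lambda>n. (cmod (u n))\<^sup>2) has_sum U) UNIV"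
  shows "(\<lambda>n. u n * conformal_rhs a n) sums infsum (quartic u a) resonant"
    and "(\<Sum>n<N. cmod (u n * conformal_rhs a n)) \<le> (U + E) * L\<^sup>2"
proof -
  let ?I = "\<lambda>n. Sigma UNIV (\<lambda>j. {(k, m). n + j = k + (m::nat)})"
  have inner: "((\<lambda>x. quartic u a (n, x)) has_sum (u n * conformal_rhs a n)) (?I n)"
    if summable: "(\<lambda>x. quartic u a (n, x)) summable_on ?I n" for n and u
  \<comment> \<open>Summability is known only after multiplication by \<open>u n\<close>. Unless
    \<open>u n\<close> vanishes, in which case both sides are 0, it can be divided out.\<close>
  proof (cases "u n = 0")
    case True
    then show ?thesis
      by (auto simp: quartic_def intro!: has_sum_0)
  next
    case False
    define g where "g j = (\<Sum>k=0..n + j. of_nat (interaction_coeff n j k (n + j - k))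
                          * cnj (a j) * a k * a (n + j - k))" for j
    have fib: "((\<lambda>y. quartic u a (n, j, y)) has_sum (u n * g j)) {(k, m). n + j = k + m}" for j
    proof (rule has_sum_finiteI[OF finite_resonant_fibre])
      show "u n * g j = (\<Sum>y\<in>{(k, m). n + j = k + m}. quartic u a (n, j, y))"
        unfolding g_def sum_distrib_left
        by (subst sum.reindex_bij_betw[OF bij_betw_resonant_fibre, symmetric])
           (simp add: quartic_def)
    qed
    obtain S where S: "((\<lambda>x. quartic u a (n, x)) has_sum S) (?I n)"
      using summable by (auto simp: summable_on_def)
    have "((\<lambda>j. u n * g j) has_sum S) UNIV"
      using has_sum_SigmaD[OF S fib] by simp
    then have "(\<lambda>j. u n * g j) sums S" by (rule has_sum_imp_sums)
    from sums_mult[OF this, of "inverse (u n)"] False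
    have "g sums (inverse (u n) * S)" by (simp add: field_simps)
    then have "conformal_rhs a n = inverse (u n) * S"
      unfolding conformal_rhs_def g_def by (simp add: sums_iff)
    then have "u n * conformal_rhs a n = S" using False by simp
    with S show ?thesis by simp
  qed
  have abs: "quartic u a abs_summable_on resonant"
    using quartic_abs_summable[OF U E L] by simp
  then have sm: "quartic u a summable_on resonant"
    by (rule abs_summable_summable)
  then have sec: "(\<lambda>x. quartic u a (n, x)) summable_on ?I n" for n
    using summable_on_SigmaD1[of "\<lambda>n x. quartic u a (n, x)" UNIV ?I n]
    by (simp add: resonant_eq_Sigma case_prod_unfold)
  have "((\<lambda>n. u n * conformal_rhs a n) has_sum infsum (quartic u a) resonant) UNIV"
    using has_sum_SigmaD[OF has_sum_infsum[OF sm, unfolded resonant_eq_Sigma] inner[OF sec]]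
    by (simp add: resonant_eq_Sigma)
  then show "(\<lambda>n. u n * conformal_rhs a n) sums infsum (quartic u a) resonant"
    by (rule has_sum_imp_sums)
  have absI: "\<And>n. (\<lambda>x. quartic u a (n, x)) abs_summable_on ?I n"
    and outer: "(\<lambda>n. \<Sum>\<^sub>\<infinity>x\<in>?I n. norm (quartic u a (n, x))) summable_on UNIV"
    using abs unfolding resonant_eq_Sigma abs_summable_on_Sigma_iff
    by (auto simp: infsum_nonneg)
  have "(\<Sum>n<N. cmod (u n * conformal_rhs a n))
      \<le> (\<Sum>n<N. \<Sum>\<^sub>\<infinity>x\<in>?I n. norm (quartic u a (n, x)))"
    using norm_infsum_bound[OF absI] infsumI[OF inner[OF sec]] by (intro sum_mono) metis
  also have "\<dots> \<le> (\<Sum>\<^sub>\<infinity>n. \<Sum>\<^sub>\<infinity>x\<in>?I n. norm (quartic u a (n, x)))"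
    by (rule finite_sum_le_infsum[OF outer]) (auto intro: infsum_nonneg)
  also have "\<dots> = (\<Sum>\<^sub>\<infinity>x\<in>resonant. norm (quartic u a x))"
    using infsum_Sigma_banach[of "\<lambda>x. norm (quartic u a x)" UNIV ?I] abs
    by (simp add: resonant_eq_Sigma)
  also have "\<dots> \<le> (U + E) * L\<^sup>2"
    using quartic_abs_summable[OF U E L] by simp
  finally show "(\<Sum>n<N. cmod (u n * conformal_rhs a n)) \<le> (U + E) * L\<^sup>2" .
qed

section \<open>Cancellations from the symmetries of the resonant set\<close>

lemma has_sum_resonant_swap:
  assumes "(f has_sum S) resonant"
  shows "((\<lambda>(n, j, k, m). f (j, n, k, m)) has_sum S) resonant"
  using assms
  by (subst has_sum_reindex_bij_witness[where h = f and T = resonant and s' = S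
        and i = "\<lambda>(n, j, k, m). (j, n, k, m)" and j = "\<lambda>(n, j, k, m). (j, n, k, m)"])
     (auto simp: resonant_def)

lemma has_sum_resonant_exchange:
  assumes "(f has_sum S) resonant"
  shows "((\<lambda>(n, j, k, m). f (k, m, n, j)) has_sum S) resonant"
  using assms
  by (subst has_sum_reindex_bij_witness[where h = f and T = resonant and s' = S
        and i = "\<lambda>(n, j, k, m). (k, m, n, j)" and j = "\<lambda>(n, j, k, m). (k, m, n, j)"])
     (auto simp: resonant_def)

lemma has_sum_cnj: "(f has_sum S) A \<Longrightarrow> ((\<lambda>x. cnj (f x)) has_sum cnj S) A"
  by simp

text \<open>Symmetrizing in \<open>n\<close> and \<open>j\<close> produces the weight
  \<open>w n + w j\<close>; exchanging the pairs \<open>(n, j)\<close> and \<open>(k, m)\<close>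
  conjugates the monomial and produces \<open>w k + w m\<close>. As these weights agree, the
  symmetrized sum equals its conjugate. The weights 1 and \<open>n + 1\<close> will give the
  conservation of \<open>Q\<close> and \<open>E\<close>.\<close>

lemma Im_quartic_additive_weight:
  assumes w: "\<And>n j k m. n + j = k + m \<Longrightarrow> w n + w j = w k + (w m :: real)"
    and P: "(quartic (\<lambda>n. of_real (w n) * cnj (a n)) a has_sum P) resonant"
  shows "Im P = 0"
proof -
  define f where "f = quartic (\<lambda>n. of_real (w n) * cnj (a n)) a"
  note P' = P[folded f_def]
  have L: "((\<lambda>x. f x + (\<lambda>(n, j, k, m). f (j, n, k, m)) x) has_sum (P + P)) resonant"
    by (intro has_sum_add P' has_sum_resonant_swap)
  have R: "((\<lambda>x. cnj ((\<lambda>(n, j, k, m). f (k, m, n, j)) x)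
      + cnj ((\<lambda>(n, j, k, m). f (m, k, n, j)) x)) has_sum (cnj P + cnj P)) resonant"
    using has_sum_resonant_exchange[OF P']
          has_sum_resonant_exchange[OF has_sum_resonant_swap[OF P']]
    by (intro has_sum_add has_sum_cnj) (auto simp: case_prod_unfold)
  have eq: "f x + (\<lambda>(n, j, k, m). f (j, n, k, m)) x =
      cnj ((\<lambda>(n, j, k, m). f (k, m, n, j)) x) + cnj ((\<lambda>(n, j, k, m). f (m, k, n, j)) x)"
    if x: "x \<in> resonant" for x
  proof (cases x)
    case (fields n j k m)
    define M where "M = of_nat (interaction_coeff n j k m) * cnj (a n) * cnj (a j) * a k * a m"
    have S: "interaction_coeff j n k m = interaction_coeff n j k m"
      "interaction_coeff k m n j = interaction_coeff n j k m"
      "interaction_coeff m k n j = interaction_coeff n j k m"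
      by (simp_all add: interaction_coeff_def insert_commute)
    have "w n + w j = w k + w m" using x fields by (intro w) (auto simp: resonant_def)
    then have "of_real (w n + w j) * M = of_real (w k + w m) * M" by simp
    then show ?thesis
      by (simp add: fields f_def quartic_def S M_def algebra_simps)
  qed
  from R have "((\<lambda>x. f x + (\<lambda>(n, j, k, m). f (j, n, k, m)) x) has_sum (cnj P + cnj P)) resonant"
    by (subst has_sum_cong[OF eq])
  from has_sum_unique[OF L this] have "P + P = cnj P + cnj P" .
  then show ?thesis by (simp add: complex_eq_iff)
qed

text \<open>The first two minima equal \<open>interaction_coeff (n - 1) j k m\<close> and
  \<open>interaction_coeff (j - 1) n k m\<close>, continued by the value 0 when the shifted index is 0.\<close>

lemma interaction_coeff_shift_identity:
  assumes "n + j = k + m + (1::nat)"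
  shows "(n+1) * Min {n, j+1, k+1, m+1} + (j+1) * Min {j, n+1, k+1, m+1}
       = (k+1) * interaction_coeff (k+1) m n j + (m+1) * interaction_coeff (m+1) k n j"
proof -
  \<comment> \<open>Both sides are invariant under swapping \<open>n\<close> with \<open>j\<close>
    and under swapping \<open>k\<close> with \<open>m\<close>, so each pair may be taken
    ordered.\<close>
  have *: "(n+1) * Min {n, j+1, k+1, m+1} + (j+1) * Min {j, n+1, k+1, m+1}
       = (k+1) * interaction_coeff (k+1) m n j + (m+1) * interaction_coeff (m+1) k n j"
    if h: "n + j = k + m + (1::nat)" "j \<le> n" "k \<le> m" for n j k m
  \<comment> \<open>The resonance orders the larger indices the opposite way: \<open>n\<close> is at
    most \<open>m\<close> if \<open>k < j\<close>, and exceeds \<open>m\<close> otherwise. All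
    minima are then determined by \<open>k\<close> alone or by \<open>j\<close> alone.\<close>
  proof (cases "k < j")
    case True
    then have "n \<le> m" using h by linarith
    then have "Min {n, j+1, k+1, m+1} = k + 1" "Min {j, n+1, k+1, m+1} = k + 1"
      "interaction_coeff (k+1) m n j = k + 2" "interaction_coeff (m+1) k n j = k + 1"
      using True h by (auto simp: interaction_coeff_def)
    moreover have "(n + 1) * (k + 1) + (j + 1) * (k + 1) = (n + j + 2) * (k + 1)"
      "(k + 1) * (k + 2) + (m + 1) * (k + 1) = (k + m + 1 + 2) * (k + 1)"
      by (simp_all add: algebra_simps)
    ultimately show ?thesis using h(1) by (simp only:)
  next
    case False
    then have "m + 1 \<le> n" using h by linarith
    then have "Min {n, j+1, k+1, m+1} = j + 1" "Min {j, n+1, k+1, m+1} = j"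
      "interaction_coeff (k+1) m n j = j + 1" "interaction_coeff (m+1) k n j = j + 1"
      using False h by (auto simp: interaction_coeff_def)
    moreover have "(n + 1) * (j + 1) + (j + 1) * j = (n + j + 1) * (j + 1)"
      "(k + 1) * (j + 1) + (m + 1) * (j + 1) = (k + m + 1 + 1) * (j + 1)"
      by (simp_all add: algebra_simps)
    ultimately show ?thesis using h(1) by (simp only:)
  qed
  consider "j \<le> n" "k \<le> m" | "j \<le> n" "m \<le> k" | "n \<le> j" "k \<le> m" | "n \<le> j" "m \<le> k"
    by linarith
  then show ?thesis
  proof cases
    case 1
    then show ?thesis using *[of n j k m] assms by simp
  next
    case 2
    then show ?thesis using *[of n j m k] assms
      by (simp add: interaction_coeff_def min.commute min.left_commute add.commute add.left_commute)
  next
    case 3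
    then show ?thesis using *[of j n k m] assms
      by (simp add: interaction_coeff_def min.commute min.left_commute add.commute add.left_commute)
  next
    case 4
    then show ?thesis using *[of j n m k] assms
      by (simp add: interaction_coeff_def min.commute min.left_commute add.commute add.left_commute)
  qed
qed

text \<open>The real part of the momentum has derivative \<open>Im (P + Q)\<close>.\<close>

lemma Im_quartic_shift:
  assumes P: "(quartic (\<lambda>n. of_nat (n + 2) * cnj (a (n + 1))) a has_sum P) resonant"
    and Q: "(quartic (\<lambda>n. of_nat n * cnj (a (n - 1))) a has_sum Q) resonant"
  shows "Im (P + Q) = 0"
proof -
  \<comment> \<open>Shifting the first index in \<open>P\<close>, and conjugating and shifting in
    \<open>Q\<close>, brings both sums to the set \<open>res1\<close> with the same monomial
    \<open>M\<close>; only the integer weights in \<open>f1\<close> and \<open>f2\<close>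
    differ.\<close>
  define res1 :: "(nat \<times> nat \<times> nat \<times> nat) set" where "res1 = {(n, j, k, m). n + j = k + m + 1}"
  define M where "M = (\<lambda>n j k m. cnj (a n) * cnj (a j) * a k * a m)"
  define f1 where "f1 = (\<lambda>(n, j, k, m). of_nat ((n+1) * Min {n, j+1, k+1, m+1}) * M n j k m)"
  define f2 where "f2 = (\<lambda>(n, j, k, m). of_nat ((k+1) * interaction_coeff (k+1) m n j) * M n j k m)"
  have shift: "interaction_coeff n j k m = Min {n + 1, j + 1, k + 1, m + 1}" for n j k m
    by (simp add: interaction_coeff_def min_def)
  have "(f1 has_sum P) {x \<in> res1. fst x \<noteq> 0}"
    using P
  proof (subst (asm) has_sum_reindex_bij_witness[where h = f1 and T = "{x \<in> res1. fst x \<noteq> 0}"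
        and s' = P and i = "\<lambda>(n, j, k, m). (n - 1, j, k, m)" and j = "\<lambda>(n, j, k, m). (n + 1, j, k, m)"],
      goal_cases)
    case (5 x)
    show ?case
      by (cases x) (simp add: f1_def quartic_def M_def shift algebra_simps del: Min_insert)
  qed (auto simp: resonant_def res1_def)
  \<comment> \<open>The indices with \<open>n = 0\<close> can be added because the minimum in
    \<open>f1\<close> is 0 there.\<close>
  then have F1: "(f1 has_sum P) res1"
    by (subst (asm) has_sum_cong_neutral[where T = res1 and g = f1]) (auto simp: f1_def)
  have "(quartic (\<lambda>n. of_nat n * cnj (a (n - 1))) a has_sum Q) {x \<in> resonant. fst x \<noteq> 0}"
    using Q by (subst (asm) has_sum_cong_neutral[where T = "{x \<in> resonant. fst x \<noteq> 0}"
      and g = "quartic (\<lambda>n. of_nat n * cnj (a (n - 1))) a"]) (auto simp: quartic_def)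
  from has_sum_cnj[OF this] have F2: "(f2 has_sum cnj Q) res1"
    by (subst (asm) has_sum_reindex_bij_witness[where h = f2 and T = res1
        and s' = "cnj Q" and i = "\<lambda>(n, j, k, m). (k + 1, m, n, j)"
        and j = "\<lambda>(n, j, k, m). (k, m, n - 1, j)"])
      (auto simp: resonant_def res1_def f2_def quartic_def M_def algebra_simps)
  have F1': "((\<lambda>(n, j, k, m). f1 (j, n, k, m)) has_sum P) res1"
    using F1
    by (subst has_sum_reindex_bij_witness[where h = f1 and T = res1 and s' = P
        and i = "\<lambda>(n, j, k, m). (j, n, k, m)" and j = "\<lambda>(n, j, k, m). (j, n, k, m)"])
       (auto simp: res1_def)
  have F2': "((\<lambda>(n, j, k, m). f2 (n, j, m, k)) has_sum cnj Q) res1"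
    using F2
    by (subst has_sum_reindex_bij_witness[where h = f2 and T = res1 and s' = "cnj Q"
        and i = "\<lambda>(n, j, k, m). (n, j, m, k)" and j = "\<lambda>(n, j, k, m). (n, j, m, k)"])
       (auto simp: res1_def)
  \<comment> \<open>Neither weight matches the other directly; they agree after symmetrizing
    \<open>f1\<close> in \<open>n\<close>, \<open>j\<close> and \<open>f2\<close> in
    \<open>k\<close>, \<open>m\<close>. This yields \<open>P = cnj Q\<close>.\<close>
  have eq: "f1 x + (\<lambda>(n, j, k, m). f1 (j, n, k, m)) x = f2 x + (\<lambda>(n, j, k, m). f2 (n, j, m, k)) x"
    if x: "x \<in> res1" for x
  proof (cases x)
    case (fields n j k m)
    have "of_nat ((n+1) * Min {n, j+1, k+1, m+1} + (j+1) * Min {j, n+1, k+1, m+1}) * M n j k m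
       = of_nat ((k+1) * interaction_coeff (k+1) m n j + (m+1) * interaction_coeff (m+1) k n j) * M n j k m"
      using x fields by (subst interaction_coeff_shift_identity) (auto simp: res1_def)
    moreover have "M j n k m = M n j k m" "M n j m k = M n j k m"
      by (simp_all add: M_def)
    ultimately show ?thesis
      unfolding fields f1_def f2_def prod.case of_nat_add distrib_right by simp
  qed
  have L: "((\<lambda>x. f1 x + (\<lambda>(n, j, k, m). f1 (j, n, k, m)) x) has_sum (P + P)) res1"
    by (intro has_sum_add F1 F1')
  have "((\<lambda>x. f2 x + (\<lambda>(n, j, k, m). f2 (n, j, m, k)) x) has_sum (cnj Q + cnj Q)) res1"
    by (intro has_sum_add F2 F2')
  then have "((\<lambda>x. f1 x + (\<lambda>(n, j, k, m). f1 (j, n, k, m)) x) has_sum (cnj Q + cnj Q)) res1"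
    by (subst has_sum_cong[OF eq])
  from has_sum_unique[OF L this] have "P + P = cnj Q + cnj Q" .
  then show ?thesis by (simp add: complex_eq_iff)
qed

section \<open>Weighted square-summable sequences\<close>

text \<open>Minkowski's inequality for finite sums, passed to the limit. Pointwise domination of
  \<open>z\<close> lets it be applied to moduli of complex sums and differences alike.\<close>

lemma l2_triangle:
  fixes x y :: "nat \<Rightarrow> real"
  assumes x: "summable (\<lambda>n. (x n)\<^sup>2)" and y: "summable (\<lambda>n. (y n)\<^sup>2)"
    and z: "\<And>n. \<bar>z n\<bar> \<le> \<bar>x n\<bar> + \<bar>y n\<bar>"
  shows "summable (\<lambda>n. (z n)\<^sup>2)"
    and "sqrt (\<Sum>n. (z n)\<^sup>2) \<le> sqrt (\<Sum>n. (x n)\<^sup>2) + sqrt (\<Sum>n. (y n)\<^sup>2)"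
proof -
  let ?C = "sqrt (\<Sum>n. (x n)\<^sup>2) + sqrt (\<Sum>n. (y n)\<^sup>2)"
  have C0: "?C \<ge> 0" by (simp add: suminf_nonneg x y)
  have le: "(\<Sum>n<N. (z n)\<^sup>2) \<le> ?C\<^sup>2" for N
  proof -
    have "L2_set z {..<N} \<le> L2_set (\<lambda>n. \<bar>x n\<bar> + \<bar>y n\<bar>) {..<N}"
      unfolding L2_set_def using power_mono[OF z abs_ge_zero, where n = 2]
      by (intro real_sqrt_le_mono sum_mono) simp
    also have "\<dots> \<le> L2_set (\<lambda>n. \<bar>x n\<bar>) {..<N} + L2_set (\<lambda>n. \<bar>y n\<bar>) {..<N}"
      by (rule L2_set_triangle_ineq)
    also have "\<dots> \<le> ?C"
      unfolding L2_set_def power2_abs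
      by (intro add_mono real_sqrt_le_mono sum_le_suminf x y) auto
    finally have "(L2_set z {..<N})\<^sup>2 \<le> ?C\<^sup>2"
      by (intro power_mono) auto
    then show ?thesis by (simp add: L2_set_def sum_nonneg)
  qed
  show sz: "summable (\<lambda>n. (z n)\<^sup>2)"
    by (rule summableI_nonneg_bounded[OF _ le]) auto
  have "(\<Sum>n. (z n)\<^sup>2) \<le> ?C\<^sup>2"
    by (rule suminf_le_const[OF sz le])
  then show "sqrt (\<Sum>n. (z n)\<^sup>2) \<le> ?C"
    using C0 real_le_lsqrt by blast
qed

lemma hs_weight: "(real n + 1) powr (2 * s) * (cmod z)\<^sup>2 = ((real n + 1) powr s * cmod z)\<^sup>2"
  by (simp add: power_mult_distrib power2_eq_square flip: powr_add)

lemma hs_norm_eq: "hs_norm s a = sqrt (\<Sum>n. ((real n + 1) powr s * cmod (a n))\<^sup>2)"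
  by (simp add: hs_norm_def hs_weight)

lemma hs_space_iff: "a \<in> hs_space s \<longleftrightarrow> summable (\<lambda>n. ((real n + 1) powr s * cmod (a n))\<^sup>2)"
  by (simp add: hs_space_def hs_weight)

lemma hs_norm_nonneg: "a \<in> hs_space s \<Longrightarrow> hs_norm s a \<ge> 0"
  by (auto simp: hs_norm_eq hs_space_iff intro!: suminf_nonneg)

lemma hs_triangle:
  assumes "a \<in> hs_space s" "b \<in> hs_space s" "\<And>n. cmod (c n) \<le> cmod (a n) + cmod (b n)"
  shows "c \<in> hs_space s" and "hs_norm s c \<le> hs_norm s a + hs_norm s b"
proof -
  have "\<bar>(real n + 1) powr s * cmod (c n)\<bar>
      \<le> \<bar>(real n + 1) powr s * cmod (a n)\<bar> + \<bar>(real n + 1) powr s * cmod (b n)\<bar>" for n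
    using mult_left_mono[OF assms(3), of "(real n + 1) powr s" n]
    by (simp add: algebra_simps abs_mult)
  from l2_triangle[OF assms(1,2)[unfolded hs_space_iff] this]
  show "c \<in> hs_space s" "hs_norm s c \<le> hs_norm s a + hs_norm s b"
    by (simp_all add: hs_space_iff hs_norm_eq)
qed

lemma hs_space_mono: "a \<in> hs_space s \<Longrightarrow> r \<le> s \<Longrightarrow> a \<in> hs_space r"
  unfolding hs_space_def mem_Collect_eq
  by (erule summable_comparison_test[rotated])
     (auto intro!: exI[of _ 0] mult_right_mono powr_mono)

lemma hs_norm_mono:
  assumes "a \<in> hs_space s" "r \<le> s"
  shows "hs_norm r a \<le> hs_norm s a"
  unfolding hs_norm_def
  using assms hs_space_mono[OF assms]
  by (intro real_sqrt_le_mono suminf_le mult_right_mono powr_mono)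
     (auto simp: hs_space_def)

lemma hs_norm_sums:
  assumes "a \<in> hs_space s"
  shows "(\<lambda>n. (real n + 1) powr (2 * s) * (cmod (a n))\<^sup>2) sums (hs_norm s a)\<^sup>2"
  using assms by (simp add: hs_norm_def hs_space_def suminf_nonneg summable_sums)

lemma hs_norm_1_sums:
  assumes "a \<in> hs_space 1"
  shows "(\<lambda>n. (real n + 1)\<^sup>2 * (cmod (a n))\<^sup>2) sums (hs_norm 1 a)\<^sup>2"
  using hs_norm_sums[OF assms] by simp

lemma hs_norm_half_sums:
  assumes "a \<in> hs_space 1"
  shows "(\<lambda>n. (real n + 1) * (cmod (a n))\<^sup>2) sums (hs_norm (1/2) a)\<^sup>2"
  using hs_norm_sums[OF hs_space_mono[OF assms, of "1/2"]] by simp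

lemma hs_norm_cmult:
  assumes "a \<in> hs_space s"
  shows "(\<lambda>n. c * a n) \<in> hs_space s" and "hs_norm s (\<lambda>n. c * a n) = cmod c * hs_norm s a"
proof -
  have eq: "(real n + 1) powr (2 * s) * (cmod (c * a n))\<^sup>2
      = (cmod c)\<^sup>2 * ((real n + 1) powr (2 * s) * (cmod (a n))\<^sup>2)" for n
    by (simp add: norm_mult power_mult_distrib)
  show "(\<lambda>n. c * a n) \<in> hs_space s" "hs_norm s (\<lambda>n. c * a n) = cmod c * hs_norm s a"
    using assms by (auto simp: hs_space_def hs_norm_def eq suminf_mult real_sqrt_mult intro: summable_mult)
qed

section \<open>Tools for conservation laws of infinite series\<close>

text \<open>Instead of differentiating the series, the partial sums are integrated over
  \<open>{0..T}\<close>; their derivatives are bounded by \<open>M\<close> and tend to 0 pointwise,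
  so dominated convergence applies.\<close>

lemma conserved_series:
  fixes f g :: "nat \<Rightarrow> real \<Rightarrow> real"
  assumes T: "0 \<le> T"
    and der: "\<And>n t. t \<ge> 0 \<Longrightarrow> (f n has_vector_derivative g n t) (at t within {0..})"
    and g: "\<And>t. t \<ge> 0 \<Longrightarrow> (\<lambda>n. g n t) sums 0"
    and bd: "\<And>t N. 0 \<le> t \<Longrightarrow> t \<le> T \<Longrightarrow> \<bar>\<Sum>n<N. g n t\<bar> \<le> M"
    and f: "(\<lambda>n. f n 0) sums F0" "(\<lambda>n. f n T) sums FT"
  shows "FT = F0"
proof -
  have "((\<lambda>t. 0) has_integral (FT - F0)) {0..T}"
  proof (rule has_integral_dominated_convergence[where h = "\<lambda>_. M"])
    show "((\<lambda>t. \<Sum>n<N. g n t) has_integral ((\<Sum>n<N. f n T) - (\<Sum>n<N. f n 0))) {0..T}" for N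
    proof (rule fundamental_theorem_of_calculus[OF T])
      fix t assume "t \<in> {0..T}"
      then have "(f n has_vector_derivative g n t) (at t within {0..T})" for n
        by (intro has_vector_derivative_within_subset[OF der]) auto
      then show "((\<lambda>t. \<Sum>n<N. f n t) has_vector_derivative (\<Sum>n<N. g n t)) (at t within {0..T})"
        by (intro has_vector_derivative_sum)
    qed
    show "(\<lambda>_. M) integrable_on {0..T}" by (rule integrable_const_ivl)
    show "\<forall>t\<in>{0..T}. norm (\<Sum>n<N. g n t) \<le> M" for N using bd by simp
    show "\<forall>t\<in>{0..T}. (\<lambda>N. \<Sum>n<N. g n t) \<longlonglongrightarrow> 0" using g by (simp add: sums_def)
    show "(\<lambda>N. (\<Sum>n<N. f n T) - (\<Sum>n<N. f n 0)) \<longlonglongrightarrow> FT - F0"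
      using f by (intro tendsto_diff) (simp_all add: sums_def)
  qed
  moreover have "((\<lambda>t. 0 :: real) has_integral 0) {0..T}" by simp
  ultimately show ?thesis by (simp add: has_integral_unique)
qed

text \<open>The reverse triangle inequality makes the \<open>h^1\<close> norm continuous in time,
  and \<open>{0..T}\<close> is compact. This supplies the dominating constant before any
  conservation law is known.\<close>

lemma conformal_flow_bounded:
  assumes sol: "conformal_flow_solution a \<alpha>" and T: "0 \<le> T"
  shows "\<exists>M. \<forall>t\<in>{0..T}. hs_norm 1 (\<alpha> t) \<le> M"
proof -
  have h: "\<alpha> t \<in> hs_space 1" if "t \<ge> 0" for t
    using sol that by (simp add: conformal_flow_solution_def)
  have "continuous_on {0..} (\<lambda>t. hs_norm 1 (\<alpha> t))"
    unfolding continuous_on_def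
  proof
    fix t :: real assume t: "t \<in> {0..}"
    have lim: "((\<lambda>s. hs_norm 1 (\<lambda>n. \<alpha> s n - \<alpha> t n)) \<longlongrightarrow> 0) (at t within {0..})"
      using sol t by (simp add: conformal_flow_solution_def)
    have "\<bar>hs_norm 1 (\<alpha> s) - hs_norm 1 (\<alpha> t)\<bar> \<le> hs_norm 1 (\<lambda>n. \<alpha> s n - \<alpha> t n)" if s: "s \<ge> 0" for s
    proof -
      have d: "(\<lambda>n. \<alpha> s n - \<alpha> t n) \<in> hs_space 1"
        by (rule hs_triangle(1)[OF h[of s] h[of t]]) (use s t norm_triangle_ineq4 in auto)
      have "hs_norm 1 (\<alpha> s) \<le> hs_norm 1 (\<alpha> t) + hs_norm 1 (\<lambda>n. \<alpha> s n - \<alpha> t n)"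
        by (rule hs_triangle(2)[OF h d]) (use t norm_triangle_sub in auto)
      moreover have "hs_norm 1 (\<alpha> t) \<le> hs_norm 1 (\<alpha> s) + hs_norm 1 (\<lambda>n. \<alpha> s n - \<alpha> t n)"
        by (rule hs_triangle(2)[OF h d]) (use s in \<open>auto intro: order_trans[OF norm_triangle_sub] simp: norm_minus_commute\<close>)
      ultimately show ?thesis by linarith
    qed
    then have "\<forall>\<^sub>F s in at t within {0..}.
        norm (hs_norm 1 (\<alpha> s) - hs_norm 1 (\<alpha> t)) \<le> hs_norm 1 (\<lambda>n. \<alpha> s n - \<alpha> t n)"
      by (auto simp: eventually_at_filter)
    then have "((\<lambda>s. hs_norm 1 (\<alpha> s) - hs_norm 1 (\<alpha> t)) \<longlongrightarrow> 0) (at t within {0..})"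
      using lim by (rule Lim_null_comparison)
    then show "((\<lambda>t. hs_norm 1 (\<alpha> t)) \<longlongrightarrow> hs_norm 1 (\<alpha> t)) (at t within {0..})"
      by (simp add: LIM_zero_iff)
  qed
  then have "continuous_on {0..T} (\<lambda>t. hs_norm 1 (\<alpha> t))"
    by (rule continuous_on_subset) auto
  then have "compact ((\<lambda>t. hs_norm 1 (\<alpha> t)) ` {0..T})"
    by (intro compact_continuous_image) auto
  from compact_imp_bounded[OF this] show ?thesis
    unfolding bounded_iff by (auto intro: order_trans[OF abs_ge_self])
qed

section \<open>Conservation laws\<close>

text \<open>Equal to \<open>pi^2 / 6\<close>; it enters the embedding of \<open>h^1\<close> into the
  absolutely summable sequences.\<close>

definition inverse_square_sum :: real where
  "inverse_square_sum = (\<Sum>n. (1 / (real n + 1))\<^sup>2)"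

lemma inverse_square_summable: "summable (\<lambda>n. (1 / (real n + 1))\<^sup>2)"
proof -
  have "summable (\<lambda>n. inverse ((real (Suc n))\<^sup>2))"
    by (subst summable_Suc_iff[of "\<lambda>n. inverse ((real n)\<^sup>2)"]) (rule inverse_power_summable, simp)
  moreover have "inverse ((real (Suc n))\<^sup>2) = (1 / (real n + 1))\<^sup>2" for n
    unfolding of_nat_Suc power_one_over by (simp only: inverse_eq_divide add.commute)
  ultimately show ?thesis by simp
qed

lemma has_sum_UNIV_if_sums_nonneg:
  fixes f :: "nat \<Rightarrow> real"
  assumes "f sums S" "\<And>n. f n \<ge> 0"
  shows "(f has_sum S) UNIV"
proof (rule norm_summable_imp_has_sum[OF _ assms(1)])
  have "norm (f n) = f n" for n using assms(2)[of n] by (rule real_norm_def[THEN trans, OF abs_of_nonneg])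
  then show "summable (\<lambda>n. norm (f n))" using sums_summable[OF assms(1)] by (simp only:)
qed

text \<open>Young's inequality for the product of \<open>1 / (n + 1)\<close> and
  \<open>(n + 1) * cmod (a n)\<close>.\<close>

lemma hs_space_1_abs_summable:
  assumes a: "a \<in> hs_space 1"
  shows "\<exists>L. ((\<lambda>n. cmod (a n)) has_sum L) UNIV \<and> 0 \<le> L \<and> L \<le> inverse_square_sum + (hs_norm 1 a)\<^sup>2"
proof -
  note E = hs_norm_1_sums[OF a]
  have le: "cmod (a n) \<le> (1 / (real n + 1))\<^sup>2 + (real n + 1)\<^sup>2 * (cmod (a n))\<^sup>2" for n
  proof -
    have "2 * (1 / (real n + 1)) * ((real n + 1) * cmod (a n))
        \<le> (1 / (real n + 1))\<^sup>2 + ((real n + 1) * cmod (a n))\<^sup>2"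
      by (rule sum_squares_bound)
    moreover have "2 * (1 / (real n + 1)) * ((real n + 1) * cmod (a n)) = 2 * cmod (a n)"
      by (simp add: field_simps)
    ultimately show ?thesis
      using norm_ge_zero[of "a n"] unfolding power_mult_distrib by linarith
  qed
  have S: "(\<lambda>n. (1 / (real n + 1))\<^sup>2 + (real n + 1)\<^sup>2 * (cmod (a n))\<^sup>2) sums
      (inverse_square_sum + (hs_norm 1 a)\<^sup>2)"
    using inverse_square_summable unfolding inverse_square_sum_def
    by (intro sums_add E summable_sums)
  have sm: "summable (\<lambda>n. cmod (a n))"
    by (rule summable_comparison_test[OF _ sums_summable[OF S]]) (use le in auto)
  have "(\<Sum>n. cmod (a n)) \<le> inverse_square_sum + (hs_norm 1 a)\<^sup>2"
    using suminf_le[OF le sm sums_summable[OF S]] sums_unique[OF S] by simp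
  moreover have "((\<lambda>n. cmod (a n)) has_sum (\<Sum>n. cmod (a n))) UNIV"
    by (intro has_sum_UNIV_if_sums_nonneg summable_sums sm) auto
  ultimately show ?thesis using suminf_nonneg[OF sm] by auto
qed

text \<open>The bound \<open>(U + E) * L\<^sup>2\<close> from \<open>conformal_rhs_sums\<close>,
  with \<open>U\<close> and \<open>E\<close> replaced by \<open>M\<^sup>2\<close> and
  \<open>L\<close> by its bound in terms of \<open>M\<close>.\<close>

definition pairing_bound :: "real \<Rightarrow> real" where
  "pairing_bound M = 2 * M\<^sup>2 * (inverse_square_sum + M\<^sup>2)\<^sup>2"

lemma conformal_rhs_pairing:
  assumes a: "a \<in> hs_space 1" and M: "hs_norm 1 a \<le> M"
    and u: "(\<lambda>n. (cmod (u n))\<^sup>2) sums U" "U \<le> (hs_norm 1 a)\<^sup>2"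
  shows "\<exists>P. (quartic u a has_sum P) resonant \<and> (\<lambda>n. u n * conformal_rhs a n) sums P"
    and "(\<Sum>n<N. cmod (u n * conformal_rhs a n)) \<le> pairing_bound M"
proof -
  obtain L where L: "((\<lambda>n. cmod (a n)) has_sum L) UNIV" "0 \<le> L"
    "L \<le> inverse_square_sum + (hs_norm 1 a)\<^sup>2"
    using hs_space_1_abs_summable[OF a] by blast
  have E: "((\<lambda>n. ((real n + 1) * cmod (a n))\<^sup>2) has_sum (hs_norm 1 a)\<^sup>2) UNIV"
    using hs_norm_1_sums[OF a]
    by (intro has_sum_UNIV_if_sums_nonneg) (auto simp: power_mult_distrib)
  have U: "((\<lambda>n. (cmod (u n))\<^sup>2) has_sum U) UNIV"
    using u(1) by (intro has_sum_UNIV_if_sums_nonneg) auto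
  have "(quartic u a has_sum infsum (quartic u a) resonant) resonant"
    by (rule has_sum_infsum[OF abs_summable_summable[OF quartic_abs_summable(1)[OF U E L(1)]]])
  then show "\<exists>P. (quartic u a has_sum P) resonant \<and> (\<lambda>n. u n * conformal_rhs a n) sums P"
    using conformal_rhs_sums(1)[OF E L(1) U] by blast
  have M2: "(hs_norm 1 a)\<^sup>2 \<le> M\<^sup>2"
    using M hs_norm_nonneg[OF a] by (intro power_mono) auto
  have "(\<Sum>n<N. cmod (u n * conformal_rhs a n)) \<le> (U + (hs_norm 1 a)\<^sup>2) * L\<^sup>2"
    by (rule conformal_rhs_sums(2)[OF E L(1) U])
  also have "\<dots> \<le> pairing_bound M"
    unfolding pairing_bound_def using u(2) M2 L by (intro mult_mono power_mono) auto
  finally show "(\<Sum>n<N. cmod (u n * conformal_rhs a n)) \<le> pairing_bound M" .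
qed

lemma conformal_flow_hs_space:
  "conformal_flow_solution a \<alpha> \<Longrightarrow> t \<ge> 0 \<Longrightarrow> \<alpha> t \<in> hs_space 1"
  by (simp add: conformal_flow_solution_def)

lemma conformal_flow_has_vector_derivative:
  assumes "conformal_flow_solution a \<alpha>" "t \<ge> 0"
  shows "((\<lambda>s. \<alpha> s n) has_vector_derivative - \<i> * conformal_rhs (\<alpha> t) n / of_real (real n + 1))
          (at t within {0..})"
proof -
  obtain v where v: "((\<lambda>s. \<alpha> s n) has_vector_derivative v) (at t within {0..})"
    "\<i> * of_nat (n + 1) * v = conformal_rhs (\<alpha> t) n"
    using assms unfolding conformal_flow_solution_def by blast
  have nz: "(of_real (real n + 1) :: complex) \<noteq> 0"
    unfolding of_real_eq_0_iff by linarith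
  have "- \<i> * conformal_rhs (\<alpha> t) n = of_real (real n + 1) * v"
    unfolding v(2)[symmetric] by (simp add: algebra_simps)
  then have "- \<i> * conformal_rhs (\<alpha> t) n / of_real (real n + 1) = v"
    using nz by (simp add: field_simps)
  with v(1) show ?thesis by simp
qed

lemma has_vector_derivative_Re_cnj_mult:
  assumes "(x has_vector_derivative x') (at t within S)" "(y has_vector_derivative y') (at t within S)"
  shows "((\<lambda>s. Re (cnj (x s) * y s)) has_vector_derivative
          Re (cnj (x t) * y' + cnj x' * y t)) (at t within S)"
  by (rule bounded_linear.has_vector_derivative[OF bounded_linear_Re
        has_vector_derivative_mult[OF bounded_linear.has_vector_derivative[OF bounded_linear_cnj assms(1)] assms(2)]])

text \<open>The factor \<open>n + 1\<close> cancels the one in the flow equation, so the terms have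
  derivatives \<open>g n t\<close>, which sum to 0 by \<open>Im_quartic_additive_weight\<close>. The
  upper bound on \<open>w\<close> makes the test sequence square-summable for data in
  \<open>h^1\<close>.\<close>

lemma weighted_norm_conserved:
  assumes sol: "conformal_flow_solution a \<alpha>" and T: "T \<ge> 0"
    and w: "\<And>n j k m. n + j = k + m \<Longrightarrow> w n + w j = w k + (w m :: real)"
    and w_bound: "\<And>n. 0 \<le> w n \<and> w n \<le> real n + 1"
    and F: "(\<lambda>n. w n * (real n + 1) * (cmod (\<alpha> 0 n))\<^sup>2) sums F0"
           "(\<lambda>n. w n * (real n + 1) * (cmod (\<alpha> T n))\<^sup>2) sums FT"
  shows "FT = F0"
proof -
  obtain M where M: "\<And>t. t \<in> {0..T} \<Longrightarrow> hs_norm 1 (\<alpha> t) \<le> M"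
    using conformal_flow_bounded[OF sol T] by blast
  define u where "u t n = of_real (w n) * cnj (\<alpha> t n)" for t n
  define g where "g n t = 2 * Im (u t n * conformal_rhs (\<alpha> t) n)" for n t
  have u: "\<exists>U. (\<lambda>n. (cmod (u t n))\<^sup>2) sums U \<and> U \<le> (hs_norm 1 (\<alpha> t))\<^sup>2" if t: "t \<ge> 0" for t
  proof -
    note E = hs_norm_1_sums[OF conformal_flow_hs_space[OF sol t]]
    have le: "(cmod (u t n))\<^sup>2 \<le> (real n + 1)\<^sup>2 * (cmod (\<alpha> t n))\<^sup>2" for n
      unfolding u_def using w_bound[of n]
      by (auto simp: norm_mult power_mult_distrib intro!: mult_right_mono power_mono)
    have sm: "summable (\<lambda>n. (cmod (u t n))\<^sup>2)"
      by (rule summable_comparison_test[OF _ sums_summable[OF E]]) (use le in auto)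
    show ?thesis
      using suminf_le[OF le sm sums_summable[OF E]] sums_unique[OF E] summable_sums[OF sm] by auto
  qed
  have der: "((\<lambda>s. w n * (real n + 1) * (cmod (\<alpha> s n))\<^sup>2) has_vector_derivative g n t) (at t within {0..})"
    if "t \<ge> 0" for n t
  proof -
    note v = conformal_flow_has_vector_derivative[OF sol that, of n]
    have "((\<lambda>s. (w n * (real n + 1)) * Re (cnj (\<alpha> s n) * \<alpha> s n)) has_vector_derivative
        (w n * (real n + 1)) * Re (cnj (\<alpha> t n) * (- \<i> * conformal_rhs (\<alpha> t) n / of_real (real n + 1))
          + cnj (- \<i> * conformal_rhs (\<alpha> t) n / of_real (real n + 1)) * \<alpha> t n)) (at t within {0..})"
      by (intro has_vector_derivative_mult_right has_vector_derivative_Re_cnj_mult v)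
    moreover have "(w n * (real n + 1)) * Re (cnj (\<alpha> t n) * (- \<i> * conformal_rhs (\<alpha> t) n / of_real (real n + 1))
          + cnj (- \<i> * conformal_rhs (\<alpha> t) n / of_real (real n + 1)) * \<alpha> t n) = g n t"
      by (simp add: g_def u_def field_simps add_nonneg_eq_0_iff)
    moreover have "Re (cnj z * z) = (cmod z)\<^sup>2" for z
      unfolding cmod_power2 by (simp add: power2_eq_square)
    ultimately show ?thesis by simp
  qed
  have g0: "(\<lambda>n. g n t) sums 0" if t: "t \<ge> 0" for t
  proof -
    obtain U where U: "(\<lambda>n. (cmod (u t n))\<^sup>2) sums U" "U \<le> (hs_norm 1 (\<alpha> t))\<^sup>2"
      using u[OF t] by blast
    obtain P where P: "(quartic (u t) (\<alpha> t) has_sum P) resonant"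
      "(\<lambda>n. u t n * conformal_rhs (\<alpha> t) n) sums P"
      using conformal_rhs_pairing(1)[OF conformal_flow_hs_space[OF sol t] order_refl U] by blast
    have "Im P = 0"
      by (rule Im_quartic_additive_weight[OF w P(1)[unfolded u_def]])
    then show ?thesis
      using sums_mult[OF sums_Im[OF P(2)], of 2] by (simp add: g_def)
  qed
  have bd: "\<bar>\<Sum>n<N. g n t\<bar> \<le> 2 * pairing_bound M" if t: "0 \<le> t" "t \<le> T" for t N
  proof -
    obtain U where U: "(\<lambda>n. (cmod (u t n))\<^sup>2) sums U" "U \<le> (hs_norm 1 (\<alpha> t))\<^sup>2"
      using u[OF t(1)] by blast
    have "\<bar>\<Sum>n<N. g n t\<bar> \<le> (\<Sum>n<N. 2 * cmod (u t n * conformal_rhs (\<alpha> t) n))"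
      unfolding g_def abs_mult
      by (rule order_trans[OF sum_abs], rule sum_mono) (simp only: abs_mult abs_numeral mult_left_mono abs_Im_le_cmod zero_le_numeral)
    also have "\<dots> \<le> 2 * pairing_bound M"
      using conformal_rhs_pairing(2)[OF conformal_flow_hs_space[OF sol t(1)] M U, of N] t
      by (simp flip: sum_distrib_left)
    finally show ?thesis .
  qed
  show ?thesis
    by (rule conserved_series[OF T der g0 bd F])
qed

lemma hs_norm_1_conserved:
  assumes sol: "conformal_flow_solution a \<alpha>" and t: "t \<ge> 0"
  shows "(hs_norm 1 (\<alpha> t))\<^sup>2 = (hs_norm 1 (\<alpha> 0))\<^sup>2"
proof (rule weighted_norm_conserved[OF sol t, where w = "\<lambda>n. real n + 1"])
  show "real n + 1 + (real j + 1) = real k + 1 + (real m + 1)" if "n + j = k + m" for n j k m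
    using that by linarith
qed (use hs_norm_1_sums[OF conformal_flow_hs_space[OF sol]] t in \<open>auto simp: power2_eq_square\<close>)

lemma hs_norm_half_conserved:
  assumes sol: "conformal_flow_solution a \<alpha>" and t: "t \<ge> 0"
  shows "(hs_norm (1/2) (\<alpha> t))\<^sup>2 = (hs_norm (1/2) (\<alpha> 0))\<^sup>2"
  using hs_norm_half_sums[OF conformal_flow_hs_space[OF sol]] t
  by - (rule weighted_norm_conserved[OF sol t, where w = "\<lambda>n. 1"], auto)

text \<open>This is the real part of the conserved quantity
  \<open>Z = \<Sum>(n + 1) (n + 2) cnj \<alpha>\<^sub>n\<^sub>+\<^sub>1 \<alpha>\<^sub>n\<close>.\<close>

definition momentum :: "(nat \<Rightarrow> complex) \<Rightarrow> real" where
  "momentum a = (\<Sum>n. (real n + 1) * (real n + 2) * Re (cnj (a (n + 1)) * a n))"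

lemma hs_norm_1_shift_sums:
  assumes "a \<in> hs_space 1"
  shows "(\<lambda>n. (real n + 2)\<^sup>2 * (cmod (a (n + 1)))\<^sup>2) sums ((hs_norm 1 a)\<^sup>2 - (cmod (a 0))\<^sup>2)"
  using hs_norm_1_sums[OF assms]
    sums_Suc_iff[of "\<lambda>n. (real n + 1)\<^sup>2 * (cmod (a n))\<^sup>2" "(hs_norm 1 a)\<^sup>2 - (cmod (a 0))\<^sup>2"]
  by (simp add: algebra_simps)

lemma momentum_sums:
  assumes a: "a \<in> hs_space 1"
  shows "(\<lambda>n. (real n + 1) * (real n + 2) * Re (cnj (a (n + 1)) * a n)) sums momentum a"
  unfolding momentum_def
proof (rule summable_sums, rule summable_comparison_test)
  show "summable (\<lambda>n. (real n + 1)\<^sup>2 * (cmod (a n))\<^sup>2 + (real n + 2)\<^sup>2 * (cmod (a (n + 1)))\<^sup>2)"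
    using hs_norm_1_sums[OF a] hs_norm_1_shift_sums[OF a]
    by (intro summable_add) (auto dest: sums_summable)
  show "\<exists>N. \<forall>n\<ge>N. norm ((real n + 1) * (real n + 2) * Re (cnj (a (n + 1)) * a n))
      \<le> (real n + 1)\<^sup>2 * (cmod (a n))\<^sup>2 + (real n + 2)\<^sup>2 * (cmod (a (n + 1)))\<^sup>2"
  proof (intro exI[of _ 0] allI impI)
    fix n :: nat
    let ?x = "(real n + 1) * cmod (a n)" and ?y = "(real n + 2) * cmod (a (n + 1))"
    have "norm ((real n + 1) * (real n + 2) * Re (cnj (a (n + 1)) * a n))
        = (real n + 1) * (real n + 2) * \<bar>Re (cnj (a (n + 1)) * a n)\<bar>"
      by (simp add: abs_mult)
    also have "\<dots> \<le> (real n + 1) * (real n + 2) * cmod (cnj (a (n + 1)) * a n)"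
      by (intro mult_left_mono abs_Re_le_cmod) auto
    also have "\<dots> = ?x * ?y" by (simp add: norm_mult)
    also have "\<dots> \<le> ?x\<^sup>2 + ?y\<^sup>2"
    proof -
      have "0 \<le> ?x * ?y" by simp
      then show ?thesis using sum_squares_bound[of ?x ?y] by linarith
    qed
    finally show "norm ((real n + 1) * (real n + 2) * Re (cnj (a (n + 1)) * a n))
      \<le> (real n + 1)\<^sup>2 * (cmod (a n))\<^sup>2 + (real n + 2)\<^sup>2 * (cmod (a (n + 1)))\<^sup>2"
      by (simp add: power_mult_distrib)
  qed
qed

text \<open>By the product rule, differentiating \<alpha> at \<open>n\<close> pairs the right-hand
  side with \<open>u1\<close> at \<open>n\<close>, and differentiating it at \<open>n + 1\<close>
  pairs it with \<open>u2\<close> at \<open>Suc n\<close>. The two sums cancel by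
  \<open>Im_quartic_shift\<close>.\<close>

lemma momentum_conserved:
  assumes sol: "conformal_flow_solution a \<alpha>" and T: "T \<ge> 0"
  shows "momentum (\<alpha> T) = momentum (\<alpha> 0)"
proof -
  obtain M where M: "\<And>t. t \<in> {0..T} \<Longrightarrow> hs_norm 1 (\<alpha> t) \<le> M"
    using conformal_flow_bounded[OF sol T] by blast
  note h = conformal_flow_hs_space[OF sol]
  define u1 where "u1 t n = of_nat (n + 2) * cnj (\<alpha> t (n + 1))" for t n
  \<comment> \<open>At \<open>n = 0\<close> the subtraction truncates but the factor
    \<open>of_nat n\<close> vanishes, so sums involving \<open>u2\<close> may start at 0 or at
    1.\<close>
  define u2 where "u2 t n = of_nat n * cnj (\<alpha> t (n - 1))" for t n
  let ?X = "\<lambda>t n. conformal_rhs (\<alpha> t) n"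
  define g where "g n t = Im (u1 t n * ?X t n) + Im (u2 t (Suc n) * ?X t (Suc n))" for n t
  have u1: "(\<lambda>n. (cmod (u1 t n))\<^sup>2) sums ((hs_norm 1 (\<alpha> t))\<^sup>2 - (cmod (\<alpha> t 0))\<^sup>2)"
    if t: "t \<ge> 0" for t
  proof -
    have "(cmod (u1 t n))\<^sup>2 = (real n + 2)\<^sup>2 * (cmod (\<alpha> t (n + 1)))\<^sup>2" for n
      using norm_of_nat[of "n + 2", where 'a = complex]
      by (simp add: u1_def norm_mult power_mult_distrib del: norm_of_nat)
    then show ?thesis using hs_norm_1_shift_sums[OF h[OF t]] by simp
  qed
  have u2: "(\<lambda>n. (cmod (u2 t n))\<^sup>2) sums ((hs_norm 1 (\<alpha> t))\<^sup>2)" if t: "t \<ge> 0" for t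
  proof -
    have "(cmod (u2 t (Suc n)))\<^sup>2 = (real n + 1)\<^sup>2 * (cmod (\<alpha> t n))\<^sup>2" for n
      using norm_of_nat[of "n + 1", where 'a = complex]
      by (simp add: u2_def norm_mult power_mult_distrib del: norm_of_nat)
    then have "(\<lambda>n. (cmod (u2 t (Suc n)))\<^sup>2) sums ((hs_norm 1 (\<alpha> t))\<^sup>2)"
      using hs_norm_1_sums[OF h[OF t]] by simp
    then show ?thesis by (subst (asm) sums_Suc_iff) (simp add: u2_def)
  qed
  have u1le: "(hs_norm 1 (\<alpha> t))\<^sup>2 - (cmod (\<alpha> t 0))\<^sup>2 \<le> (hs_norm 1 (\<alpha> t))\<^sup>2" for t by simp
  have u20: "u2 t 0 = 0" for t by (simp add: u2_def)
  have der: "((\<lambda>s. (real n + 1) * (real n + 2) * Re (cnj (\<alpha> s (n + 1)) * \<alpha> s n))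
      has_vector_derivative g n t) (at t within {0..})" if "t \<ge> 0" for n t
  proof -
    note v = conformal_flow_has_vector_derivative[OF sol that]
    let ?c = "(real n + 1) * (real n + 2)"
    let ?D = "cnj (\<alpha> t (n + 1)) * (- \<i> * ?X t n / of_real (real n + 1))
          + cnj (- \<i> * ?X t (n + 1) / of_real (real (n + 1) + 1)) * \<alpha> t n"
    have "((\<lambda>s. ?c * Re (cnj (\<alpha> s (n + 1)) * \<alpha> s n)) has_vector_derivative ?c * Re ?D) (at t within {0..})"
      by (intro has_vector_derivative_mult_right has_vector_derivative_Re_cnj_mult v)
    moreover have "?c * Re ?D = g n t"
    proof -
      define c1 c2 :: complex where "c1 = of_real (real n + 1)" and "c2 = of_real (real n + 2)"
      have nz: "c1 \<noteq> 0" "c2 \<noteq> 0" unfolding c1_def c2_def of_real_eq_0_iff by linarith+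
      have c: "of_real ?c = c1 * c2" "of_real (real n + 1) = c1" "of_real (real (n + 1) + 1) = c2"
        "cnj c1 = c1" "cnj c2 = c2" "u1 t n = c2 * cnj (\<alpha> t (n + 1))" "u2 t (Suc n) = c1 * cnj (\<alpha> t n)"
        by (simp_all add: c1_def c2_def u1_def u2_def)
      have 1: "of_real ?c * (cnj (\<alpha> t (n + 1)) * (- \<i> * ?X t n / of_real (real n + 1)))
          = - \<i> * (u1 t n * ?X t n)"
        unfolding c using nz by (simp add: field_simps)
      have 2: "of_real ?c * (cnj (- \<i> * ?X t (n + 1) / of_real (real (n + 1) + 1)) * \<alpha> t n)
          = \<i> * cnj (u2 t (Suc n) * ?X t (Suc n))"
        unfolding c using nz by (simp add: c field_simps)
      have "?c * Re ?D = Re (of_real ?c * ?D)" by simp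
      also have "of_real ?c * ?D = - \<i> * (u1 t n * ?X t n) + \<i> * cnj (u2 t (Suc n) * ?X t (Suc n))"
        by (simp only: distrib_left[of "of_real ?c :: complex"] 1 2)
      also have "Re \<dots> = g n t" by (simp add: g_def)
      finally show ?thesis .
    qed
    ultimately show ?thesis by simp
  qed
  have g0: "(\<lambda>n. g n t) sums 0" if t: "t \<ge> 0" for t
  proof -
    obtain P where P: "(quartic (u1 t) (\<alpha> t) has_sum P) resonant" "(\<lambda>n. u1 t n * ?X t n) sums P"
      using conformal_rhs_pairing(1)[OF h[OF t] order_refl u1[OF t] u1le] by blast
    obtain Q where Q: "(quartic (u2 t) (\<alpha> t) has_sum Q) resonant" "(\<lambda>n. u2 t n * ?X t n) sums Q"
      using conformal_rhs_pairing(1)[OF h[OF t] order_refl u2[OF t] order_refl] by blast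
    have Q': "(\<lambda>n. u2 t (Suc n) * ?X t (Suc n)) sums Q"
      using Q(2) by (subst sums_Suc_iff) (simp add: u20)
    have "Im (P + Q) = 0"
      by (rule Im_quartic_shift[OF P(1)[unfolded u1_def] Q(1)[unfolded u2_def]])
    then show ?thesis
      using sums_add[OF sums_Im[OF P(2)] sums_Im[OF Q']] by (simp add: g_def)
  qed
  have bd: "\<bar>\<Sum>n<N. g n t\<bar> \<le> 2 * pairing_bound M" if t: "0 \<le> t" "t \<le> T" for t N
  proof -
    have "\<bar>\<Sum>n<N. g n t\<bar> \<le> (\<Sum>n<N. cmod (u1 t n * ?X t n) + cmod (u2 t (Suc n) * ?X t (Suc n)))"
      unfolding g_def
      by (rule order_trans[OF sum_abs], rule sum_mono, rule order_trans[OF abs_triangle_ineq])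
         (rule add_mono[OF abs_Im_le_cmod abs_Im_le_cmod])
    also have "\<dots> = (\<Sum>n<N. cmod (u1 t n * ?X t n)) + (\<Sum>n<Suc N. cmod (u2 t n * ?X t n))"
      by (subst sum.lessThan_Suc_shift) (simp add: sum.distrib u20)
    also have "\<dots> \<le> pairing_bound M + pairing_bound M"
      using t by (intro add_mono conformal_rhs_pairing(2)[OF h[OF t(1)] M u1[OF t(1)] u1le]
          conformal_rhs_pairing(2)[OF h[OF t(1)] M u2[OF t(1)] order_refl]) auto
    finally show ?thesis by simp
  qed
  show ?thesis
    by (rule conserved_series[OF T der g0 bd momentum_sums[OF h[OF order_refl]] momentum_sums[OF h[OF T]]])
qed

section \<open>Stability of the ground state\<close>

text \<open>In the expanded square, the weight \<open>(n + 1) * (n + 2)\<close> is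
  \<open>(n + 2)^2 - (n + 2)\<close> on the term of index \<open>n + 1\<close>, giving
  \<open>E - Q\<close>, and \<open>(n + 1)^2 + (n + 1)\<close> on the term of index
  \<open>n\<close>, giving \<open>E + Q\<close>.\<close>

lemma defect_sums:
  assumes a: "a \<in> hs_space 1"
  shows "(\<lambda>n. (real n + 1) * (real n + 2) * (cmod (a (n + 1) - of_real p * a n))\<^sup>2) sums
    ((1 + p\<^sup>2) * (hs_norm 1 a)\<^sup>2 - (1 - p\<^sup>2) * (hs_norm (1/2) a)\<^sup>2 - 2 * p * momentum a)"
proof -
  let ?E = "(hs_norm 1 a)\<^sup>2" and ?Q = "(hs_norm (1/2) a)\<^sup>2"
  have lower: "(\<lambda>n. (real n + 1)\<^sup>2 * (cmod (a n))\<^sup>2 - (real n + 1) * (cmod (a n))\<^sup>2) sums (?E - ?Q)"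
    and upper: "(\<lambda>n. (real n + 1)\<^sup>2 * (cmod (a n))\<^sup>2 + (real n + 1) * (cmod (a n))\<^sup>2) sums (?E + ?Q)"
    by (intro sums_diff sums_add hs_norm_1_sums hs_norm_half_sums a)+
  \<comment> \<open>The shift loses nothing: the term of index 0 in the series for
    \<open>?E - ?Q\<close> is 0.\<close>
  have lower': "(\<lambda>n. (real n + 1) * (real n + 2) * (cmod (a (Suc n)))\<^sup>2) sums (?E - ?Q)"
    using lower
      sums_Suc_iff[of "\<lambda>n. (real n + 1)\<^sup>2 * (cmod (a n))\<^sup>2 - (real n + 1) * (cmod (a n))\<^sup>2" "?E - ?Q"]
    by (simp add: algebra_simps power2_eq_square)
  have "(\<lambda>n. (real n + 1) * (real n + 2) * (cmod (a (Suc n)))\<^sup>2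
      + p\<^sup>2 * ((real n + 1)\<^sup>2 * (cmod (a n))\<^sup>2 + (real n + 1) * (cmod (a n))\<^sup>2)
      - 2 * p * ((real n + 1) * (real n + 2) * Re (cnj (a (n + 1)) * a n)))
    sums ((?E - ?Q) + p\<^sup>2 * (?E + ?Q) - 2 * p * momentum a)"
    by (intro sums_add sums_diff sums_mult lower' upper momentum_sums a)
  moreover have "(real n + 1) * (real n + 2) * (cmod (a (Suc n)))\<^sup>2
      + p\<^sup>2 * ((real n + 1)\<^sup>2 * (cmod (a n))\<^sup>2 + (real n + 1) * (cmod (a n))\<^sup>2)
      - 2 * p * ((real n + 1) * (real n + 2) * Re (cnj (a (n + 1)) * a n))
    = (real n + 1) * (real n + 2) * (cmod (a (n + 1) - of_real p * a n))\<^sup>2" for n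
    unfolding cmod_power2 by (simp add: algebra_simps power2_eq_square)
  ultimately show ?thesis by (simp add: algebra_simps)
qed

lemma sum_square_le: "(x + y)\<^sup>2 \<le> 2 * x\<^sup>2 + 2 * (y :: real)\<^sup>2"
  using sum_squares_bound[of x y] by (simp add: power2_sum)

lemma cmod_diff_square_le: "(cmod (x - y))\<^sup>2 \<le> 2 * (cmod x)\<^sup>2 + 2 * (cmod y)\<^sup>2"
  by (rule order_trans[OF power_mono[OF norm_triangle_ineq4 norm_ge_zero] sum_square_le])

text \<open>Meant for the initial deviation from the ground state, whose defect is thereby
  quadratically small. The constant is 2 + 4, the 4 coming from \<open>n + 2\<close> being at most
  \<open>2 * (n + 1)\<close>.\<close>

lemma defect_le:
  assumes a: "a \<in> hs_space 1" and p: "0 \<le> p" "p \<le> 1"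
    and R: "(\<lambda>n. (real n + 1) * (real n + 2) * (cmod (a (n + 1) - of_real p * a n))\<^sup>2) sums R"
  shows "R \<le> 6 * (hs_norm 1 a)\<^sup>2"
proof -
  let ?S = "\<lambda>n. 2 * ((real n + 2)\<^sup>2 * (cmod (a (n + 1)))\<^sup>2) + 4 * ((real n + 1)\<^sup>2 * (cmod (a n))\<^sup>2)"
  have S: "?S sums (2 * ((hs_norm 1 a)\<^sup>2 - (cmod (a 0))\<^sup>2) + 4 * (hs_norm 1 a)\<^sup>2)"
    by (intro sums_add sums_mult hs_norm_1_sums hs_norm_1_shift_sums a)
  have "(real n + 1) * (real n + 2) * (cmod (a (n + 1) - of_real p * a n))\<^sup>2 \<le> ?S n" for n
  proof -
    have "(cmod (of_real p * a n))\<^sup>2 \<le> (cmod (a n))\<^sup>2"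
      using p by (intro power_mono) (auto simp: norm_mult mult_left_le_one_le)
    then have "(cmod (a (n + 1) - of_real p * a n))\<^sup>2 \<le> 2 * (cmod (a (n + 1)))\<^sup>2 + 2 * (cmod (a n))\<^sup>2"
      using cmod_diff_square_le[of "a (n + 1)" "of_real p * a n"] by linarith
    then have "(real n + 1) * (real n + 2) * (cmod (a (n + 1) - of_real p * a n))\<^sup>2
        \<le> (real n + 1) * (real n + 2) * (2 * (cmod (a (n + 1)))\<^sup>2 + 2 * (cmod (a n))\<^sup>2)"
      by (intro mult_left_mono) auto
    also have "\<dots> = 2 * ((real n + 1) * (real n + 2) * (cmod (a (n + 1)))\<^sup>2)
        + 2 * ((real n + 1) * (real n + 2) * (cmod (a n))\<^sup>2)"
      by (simp add: algebra_simps)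
    also have "\<dots> \<le> 2 * ((real n + 2)\<^sup>2 * (cmod (a (n + 1)))\<^sup>2)
        + 2 * (2 * (real n + 1)\<^sup>2 * (cmod (a n))\<^sup>2)"
      by (intro add_mono mult_left_mono mult_right_mono) (auto simp: power2_eq_square algebra_simps)
    finally show ?thesis by simp
  qed
  from sums_le[OF this R S] show ?thesis
    by (rule order_trans) simp
qed

section \<open>Distance to geometric sequences\<close>

text \<open>Convexity of the square with weights \<open>p\<close> and \<open>1 - p\<close> gives
  \<open>(p * c + s)^2\<close> at most \<open>p * c^2 + s^2 / (1 - p)\<close>. Since
  \<open>c 0 = 0\<close>, summing allows the \<open>c\<close> terms on the right to be absorbed on
  the left.\<close>

lemma l2_recursion:
  fixes c s :: "nat \<Rightarrow> real"
  assumes p: "0 \<le> p" "p < 1" and c0: "c 0 = 0" and c: "\<And>n. 0 \<le> c n"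
    and rec: "\<And>n. c (Suc n) \<le> p * c n + s n"
    and s: "summable (\<lambda>n. (s n)\<^sup>2)" "(\<Sum>n. (s n)\<^sup>2) \<le> S"
  shows "summable (\<lambda>n. (c n)\<^sup>2)" and "(\<Sum>n. (c n)\<^sup>2) \<le> S / (1 - p)\<^sup>2"
proof -
  have step: "(c (Suc n))\<^sup>2 \<le> p * (c n)\<^sup>2 + (s n)\<^sup>2 / (1 - p)" for n
  proof -
    have "p * (c n)\<^sup>2 + (s n)\<^sup>2 / (1 - p) - (p * c n + s n)\<^sup>2 = p * ((1 - p) * c n - s n)\<^sup>2 / (1 - p)"
      using p by (simp add: field_simps power2_eq_square)
    also have "\<dots> \<ge> 0" using p by simp
    finally have "(p * c n + s n)\<^sup>2 \<le> p * (c n)\<^sup>2 + (s n)\<^sup>2 / (1 - p)" by simp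
    moreover have "(c (Suc n))\<^sup>2 \<le> (p * c n + s n)\<^sup>2"
      using rec c by (intro power_mono)
    ultimately show ?thesis by linarith
  qed
  have bound: "(\<Sum>n<N. (c n)\<^sup>2) \<le> S / (1 - p)\<^sup>2" for N
  proof -
    let ?C = "\<Sum>n<N. (c n)\<^sup>2"
    have "?C \<le> (\<Sum>n<Suc N. (c n)\<^sup>2)" by simp
    also have "\<dots> = (\<Sum>n<N. (c (Suc n))\<^sup>2)"
      by (subst sum.lessThan_Suc_shift) (simp add: c0)
    also have "\<dots> \<le> (\<Sum>n<N. p * (c n)\<^sup>2 + (s n)\<^sup>2 / (1 - p))"
      by (intro sum_mono step)
    also have "\<dots> = p * ?C + (\<Sum>n<N. (s n)\<^sup>2) / (1 - p)"
      by (simp add: sum.distrib sum_distrib_left sum_divide_distrib)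
    also have "(\<Sum>n<N. (s n)\<^sup>2) \<le> S"
      using sum_le_suminf[OF s(1), of "{..<N}"] s(2) by simp
    finally have "?C \<le> p * ?C + S / (1 - p)"
      using p by (simp add: divide_right_mono)
    then have "(1 - p) * ?C \<le> S / (1 - p)" by (simp add: algebra_simps)
    then have "?C \<le> S / (1 - p) / (1 - p)"
      using p by (subst pos_le_divide_eq) (auto simp: mult.commute)
    then show ?thesis by (simp add: power2_eq_square)
  qed
  show "summable (\<lambda>n. (c n)\<^sup>2)"
    by (rule summableI_nonneg_bounded[OF _ bound]) auto
  then show "(\<Sum>n. (c n)\<^sup>2) \<le> S / (1 - p)\<^sup>2"
    by (rule suminf_le_const[OF _ bound])
qed

text \<open>The error \<open>b\<close> starts at 0 and satisfies \<open>b (n + 1) = p * b n\<close>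
  plus the defect at \<open>n\<close>. The recursion estimate is used twice, first without weight
  and then with weight \<open>n + 1\<close>.\<close>

lemma geometric_approximation:
  assumes p: "0 \<le> p" "p < 1"
    and R: "(\<lambda>n. (real n + 1) * (real n + 2) * (cmod (a (n + 1) - of_real p * a n))\<^sup>2) sums R"
  shows "(\<lambda>n. a n - of_real p ^ n * a 0) \<in> hs_space 1"
    and "(hs_norm 1 (\<lambda>n. a n - of_real p ^ n * a 0))\<^sup>2 \<le> 6 * R / (1 - p) ^ 4"
proof -
  define b where "b = (\<lambda>n. a n - of_real p ^ n * a 0)"
  define r where "r n = cmod (a (n + 1) - of_real p * a n)" for n
  have R': "(\<lambda>n. (real n + 1) * (real n + 2) * (r n)\<^sup>2) sums R"
    using R by (simp add: r_def)
  have b_rec: "cmod (b (Suc n)) \<le> p * cmod (b n) + r n" for n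
  proof -
    have "b (Suc n) = of_real p * b n + (a (n + 1) - of_real p * a n)"
      by (simp add: b_def algebra_simps)
    then have "cmod (b (Suc n)) \<le> cmod (of_real p * b n) + r n"
      using norm_triangle_ineq unfolding r_def by metis
    then show ?thesis using p by (simp add: norm_mult)
  qed
  have r_le: "(r n)\<^sup>2 \<le> (real n + 1) * (real n + 2) * (r n)\<^sup>2"
    and r_le': "((real n + 2) * r n)\<^sup>2 \<le> 2 * ((real n + 1) * (real n + 2) * (r n)\<^sup>2)" for n
  proof -
    have "1 * (r n)\<^sup>2 \<le> (real n + 1) * (real n + 2) * (r n)\<^sup>2"
      by (intro mult_right_mono) (auto simp: algebra_simps)
    then show "(r n)\<^sup>2 \<le> (real n + 1) * (real n + 2) * (r n)\<^sup>2" by simp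
    have "(real n + 2)\<^sup>2 * (r n)\<^sup>2 \<le> (2 * ((real n + 1) * (real n + 2))) * (r n)\<^sup>2"
      by (intro mult_right_mono) (auto simp: algebra_simps power2_eq_square)
    then show "((real n + 2) * r n)\<^sup>2 \<le> 2 * ((real n + 1) * (real n + 2) * (r n)\<^sup>2)"
      by (simp add: power_mult_distrib)
  qed
  have r_sum: "summable (\<lambda>n. (r n)\<^sup>2)"
    by (rule summable_comparison_test[OF _ sums_summable[OF R']]) (use r_le in auto)
  have r_suminf: "(\<Sum>n. (r n)\<^sup>2) \<le> R"
    using suminf_le[OF r_le r_sum sums_summable[OF R']] sums_unique[OF R'] by simp
  have b0: "b 0 = 0" by (simp add: b_def)
  note B = l2_recursion[of p "\<lambda>n. cmod (b n)" r R, OF p _ _ b_rec r_sum r_suminf, unfolded b0, simplified]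
  \<comment> \<open>Passing from the weight \<open>n + 1\<close> to \<open>n + 2\<close> leaves an
    extra \<open>p * cmod (b n)\<close>, which joins the source term and is controlled by the
    unweighted estimate.\<close>
  define s where "s n = p * cmod (b n) + (real n + 2) * r n" for n
  have s_le: "(s n)\<^sup>2 \<le> 2 * (cmod (b n))\<^sup>2 + 4 * ((real n + 1) * (real n + 2) * (r n)\<^sup>2)" for n
  proof -
    have "(p * cmod (b n))\<^sup>2 \<le> (cmod (b n))\<^sup>2"
      using p by (intro power_mono) (auto simp: mult_left_le_one_le)
    then show ?thesis
      using sum_square_le[of "p * cmod (b n)" "(real n + 2) * r n"] r_le'[of n] unfolding s_def by linarith
  qed
  have T: "(\<lambda>n. 2 * (cmod (b n))\<^sup>2 + 4 * ((real n + 1) * (real n + 2) * (r n)\<^sup>2)) sums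
      (2 * (\<Sum>n. (cmod (b n))\<^sup>2) + 4 * R)"
    by (intro sums_add sums_mult R' summable_sums B)
  have s_sum: "summable (\<lambda>n. (s n)\<^sup>2)"
    by (rule summable_comparison_test[OF _ sums_summable[OF T]]) (use s_le in auto)
  have R0: "R \<ge> 0"
    using r_suminf suminf_nonneg[OF r_sum] by auto
  have q: "0 < (1 - p)\<^sup>2" "(1 - p)\<^sup>2 \<le> 1"
    using p by (auto simp: power2_eq_square mult_le_one)
  have s_suminf: "(\<Sum>n. (s n)\<^sup>2) \<le> 6 * R / (1 - p)\<^sup>2"
  proof -
    have "(\<Sum>n. (s n)\<^sup>2) \<le> 2 * (\<Sum>n. (cmod (b n))\<^sup>2) + 4 * R"
      using suminf_le[OF s_le s_sum sums_summable[OF T]] sums_unique[OF T] by simp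
    also have "\<dots> \<le> 2 * (R / (1 - p)\<^sup>2) + 4 * (R / (1 - p)\<^sup>2)"
    proof -
      have "R \<le> R / (1 - p)\<^sup>2"
        using q R0 by (simp add: pos_le_divide_eq mult_right_le_one_le)
      then show ?thesis using B(2) by linarith
    qed
    finally show ?thesis by simp
  qed
  have c_rec: "(real (Suc n) + 1) * cmod (b (Suc n)) \<le> p * ((real n + 1) * cmod (b n)) + s n" for n
  proof -
    have "(real n + 2) * cmod (b (Suc n)) \<le> (real n + 2) * (p * cmod (b n) + r n)"
      by (intro mult_left_mono b_rec) auto
    then show ?thesis by (simp add: s_def algebra_simps)
  qed
  note C = l2_recursion[of p "\<lambda>n. (real n + 1) * cmod (b n)" s "6 * R / (1 - p)\<^sup>2",
      OF p _ _ c_rec s_sum s_suminf, unfolded b0, simplified]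
  have mem: "b \<in> hs_space 1" using C(1) by (simp add: hs_space_iff)
  moreover have "(hs_norm 1 b)\<^sup>2 \<le> 6 * R / (1 - p) ^ 4"
  proof -
    have "(hs_norm 1 b)\<^sup>2 = (\<Sum>n. ((real n + 1) * cmod (b n))\<^sup>2)"
      unfolding hs_norm_eq by (subst real_sqrt_pow2) (use C(1) in \<open>auto intro!: suminf_nonneg\<close>)
    also have "\<dots> \<le> 6 * R / (1 - p)\<^sup>2 / (1 - p)\<^sup>2" using C(2) by simp
    also have "\<dots> = 6 * R / (1 - p) ^ 4" by (simp add: power2_eq_square power4_eq_xxxx)
    finally show ?thesis .
  qed
  ultimately show "(\<lambda>n. a n - of_real p ^ n * a 0) \<in> hs_space 1"
    "(hs_norm 1 (\<lambda>n. a n - of_real p ^ n * a 0))\<^sup>2 \<le> 6 * R / (1 - p) ^ 4"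
    by (simp_all add: b_def)
qed

section \<open>The ground state and its orbit\<close>

lemma ground_state_hs_space:
  assumes p: "0 < p" "p < 1"
  shows "ground_state p \<in> hs_space 1"
proof -
  \<comment> \<open>These coefficients are \<open>(n + 1) * (n + 2)\<close>, which dominate the
    squared weight \<open>(n + 1)^2\<close>.\<close>
  have "summable (\<lambda>n. diffs (\<lambda>n. of_nat (Suc n)) n * (p\<^sup>2) ^ n)"
  proof (rule termdiff_converges)
    show "norm (p\<^sup>2) < 1" using p by (simp add: abs_square_less_1)
    show "summable (\<lambda>n. of_nat (Suc n) * x ^ n)" if "norm x < 1" for x :: real
      using geometric_deriv_sums[OF that] by (rule sums_summable)
  qed
  then have "summable (\<lambda>n. (1 - p\<^sup>2)\<^sup>2 * (diffs (\<lambda>n. of_nat (Suc n)) n * (p\<^sup>2) ^ n))"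
    by (rule summable_mult)
  moreover have "norm (((real n + 1) powr 1 * cmod (ground_state p n))\<^sup>2)
      \<le> (1 - p\<^sup>2)\<^sup>2 * (diffs (\<lambda>n. of_nat (Suc n)) n * (p\<^sup>2) ^ n)" for n
  proof -
    have "((real n + 1) powr 1 * cmod (ground_state p n))\<^sup>2 = (1 - p\<^sup>2)\<^sup>2 * ((real n + 1)\<^sup>2 * (p\<^sup>2) ^ n)"
      unfolding ground_state_def norm_of_real
      by (simp add: power_mult_distrib power2_abs power_mult[symmetric] mult.commute abs_mult)
    also have "\<dots> \<le> (1 - p\<^sup>2)\<^sup>2 * (diffs (\<lambda>n. of_nat (Suc n)) n * (p\<^sup>2) ^ n)"
    proof -
      have "(real n + 1)\<^sup>2 \<le> diffs (\<lambda>n. of_nat (Suc n)) n"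
        by (simp add: diffs_def power2_eq_square algebra_simps)
      then show ?thesis by (intro mult_left_mono mult_right_mono) auto
    qed
    finally show ?thesis by simp
  qed
  ultimately show ?thesis
    unfolding hs_space_iff by (rule summable_comparison_test'[where N = 0])
qed

text \<open>The series of \<open>(n + 1) * p^(2 * n)\<close> sums to \<open>1 / (1 - p^2)^2\<close>,
  which the prefactor cancels. The \<open>h^(1/2)\<close> norm of a multiple of the ground state is
  therefore the modulus of the multiple.\<close>

lemma hs_norm_half_ground_state:
  assumes p: "0 < p" "p < 1"
  shows "hs_norm (1/2) (ground_state p) = 1"
proof -
  have lt: "p\<^sup>2 < 1" using p by (simp add: abs_square_less_1)
  have "(\<lambda>n. (1 - p\<^sup>2)\<^sup>2 * (of_nat (Suc n) * (p\<^sup>2) ^ n)) sums ((1 - p\<^sup>2)\<^sup>2 * (1 / (1 - p\<^sup>2)\<^sup>2))"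
    using lt by (intro sums_mult geometric_deriv_sums) simp
  moreover have "(1 - p\<^sup>2)\<^sup>2 * (of_nat (Suc n) * (p\<^sup>2) ^ n) = (real n + 1) * (cmod (ground_state p n))\<^sup>2" for n
    unfolding ground_state_def norm_of_real power2_abs
    by (simp add: power_mult_distrib power_mult[symmetric] mult.commute mult.left_commute add.commute)
  ultimately have "(\<lambda>n. (real n + 1) * (cmod (ground_state p n))\<^sup>2) sums 1"
    using lt by simp
  from sums_unique2[OF hs_norm_half_sums[OF ground_state_hs_space[OF p]] this]
  have "(hs_norm (1/2) (ground_state p))\<^sup>2 = 1" .
  then show ?thesis
    using hs_norm_nonneg[OF hs_space_mono[OF ground_state_hs_space[OF p], of "1/2"]]
    by (simp add: power2_eq_1_iff)
qed

text \<open>A phase rotation with \<mu> equal to 0 is one candidate in the infimum, and all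
  candidates have nonnegative norm because the differences lie in \<open>h^1\<close>.\<close>

lemma hs_dist_orbit_le:
  assumes a: "a \<in> hs_space 1" and s: "s \<le> 1" and p: "0 < p" "p < 1"
  shows "hs_dist s a (ground_state_orbit p) \<le> hs_norm 1 (\<lambda>n. a n - exp (\<i> * of_real \<theta>) * ground_state p n)"
proof -
  have diff: "(\<lambda>n. a n - b n) \<in> hs_space 1" if "b \<in> ground_state_orbit p" for b
  proof (rule hs_triangle(1)[OF a ground_state_hs_space[OF p]])
    fix n
    have "cmod (b n) = cmod (ground_state p n)"
      using that by (auto simp: ground_state_orbit_def norm_mult simp flip: exp_add)
    then show "cmod (a n - b n) \<le> cmod (a n) + cmod (ground_state p n)"
      using norm_triangle_ineq4[of "a n" "b n"] by simp
  qed
  have mem: "(\<lambda>n. exp (\<i> * of_real \<theta>) * ground_state p n) \<in> ground_state_orbit p"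
    unfolding ground_state_orbit_def by (rule CollectI, rule exI[of _ \<theta>], rule exI[of _ 0], simp)
  have "hs_dist s a (ground_state_orbit p) \<le> hs_norm s (\<lambda>n. a n - exp (\<i> * of_real \<theta>) * ground_state p n)"
    unfolding hs_dist_def
    using hs_norm_nonneg[OF hs_space_mono[OF diff s]]
    by (intro cINF_lower[OF _ mem] bdd_belowI2[where m = 0])
  also have "\<dots> \<le> hs_norm 1 (\<lambda>n. a n - exp (\<i> * of_real \<theta>) * ground_state p n)"
    by (rule hs_norm_mono[OF diff[OF mem] s])
  finally show ?thesis .
qed

text \<open>The conserved defect is at most \<open>6 * \<delta>\<^sup>2\<close>, so the solution
  stays within \<open>K * \<delta>\<close> of some multiple \<open>c\<close> of the ground state.
  Conservation of the \<open>h^(1/2)\<close> norm keeps the modulus of \<open>c\<close> near 1, and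
  its argument gives the angle.\<close>

lemma ground_state_orbitally_stable:
  assumes p: "0 < p" "p < 1"
    and a: "a \<in> hs_space 1" "hs_norm 1 (\<lambda>n. a n - ground_state p n) \<le> \<delta>"
    and sol: "conformal_flow_solution a \<alpha>" and t: "t \<ge> 0"
  defines "K \<equiv> 6 / (1 - p)\<^sup>2"
  shows "\<exists>\<theta>. hs_norm 1 (\<lambda>n. \<alpha> t n - exp (\<i> * of_real \<theta>) * ground_state p n)
      \<le> (K + (1 + K) * hs_norm 1 (ground_state p)) * \<delta>"
proof -
  let ?A = "ground_state p" and ?x = "\<alpha> t"
  note A = ground_state_hs_space[OF p]
  note x = conformal_flow_hs_space[OF sol t]
  have \<alpha>0: "\<alpha> 0 = a" using sol by (simp add: conformal_flow_solution_def)
  have K: "K \<ge> 0" by (simp add: K_def)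
  define d where "d = (\<lambda>n. a n - ?A n)"
  have d: "d \<in> hs_space 1"
    unfolding d_def by (rule hs_triangle(1)[OF a(1) A]) (rule norm_triangle_ineq4)
  have d_le: "hs_norm 1 d \<le> \<delta>" using a(2) by (simp add: d_def)
  then have \<delta>: "\<delta> \<ge> 0" using hs_norm_nonneg[OF d] by linarith
  obtain R where R: "(\<lambda>n. (real n + 1) * (real n + 2) * (cmod (?x (n + 1) - of_real p * ?x n))\<^sup>2) sums R"
    "(\<lambda>n. (real n + 1) * (real n + 2) * (cmod (a (n + 1) - of_real p * a n))\<^sup>2) sums R"
    using defect_sums[OF x, of p] defect_sums[OF a(1), of p]
    by (simp add: hs_norm_1_conserved[OF sol t] hs_norm_half_conserved[OF sol t]
        momentum_conserved[OF sol t] \<alpha>0)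
  \<comment> \<open>The ground state has zero defect, so only the deviation \<open>d\<close>
    contributes.\<close>
  have "a (n + 1) - of_real p * a n = d (n + 1) - of_real p * d n" for n
    by (simp add: d_def ground_state_def algebra_simps)
  with R(2) have "(\<lambda>n. (real n + 1) * (real n + 2) * (cmod (d (n + 1) - of_real p * d n))\<^sup>2) sums R"
    by simp
  from defect_le[OF d _ _ this] p have "R \<le> 6 * (hs_norm 1 d)\<^sup>2" by simp
  also have "\<dots> \<le> 6 * \<delta>\<^sup>2"
    using d_le hs_norm_nonneg[OF d] by (intro mult_left_mono power_mono) auto
  finally have R_le: "R \<le> 6 * \<delta>\<^sup>2" .
  define b where "b = (\<lambda>n. ?x n - of_real p ^ n * ?x 0)"
  note geo = geometric_approximation[OF _ p(2) R(1)]
  have b: "b \<in> hs_space 1" using geo p by (simp add: b_def)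
  have b_le: "hs_norm 1 b \<le> K * \<delta>"
  proof (rule power2_le_imp_le)
    have "(hs_norm 1 b)\<^sup>2 \<le> 6 * R / (1 - p) ^ 4" using geo p by (simp add: b_def)
    also have "\<dots> \<le> 6 * (6 * \<delta>\<^sup>2) / (1 - p) ^ 4"
      using R_le by (intro divide_right_mono mult_left_mono) auto
    \<comment> \<open>This fixes \<open>K\<close>: one factor 6 comes from \<open>defect_le\<close>,
      the other from \<open>geometric_approximation\<close>.\<close>
    also have "\<dots> = (K * \<delta>)\<^sup>2"
      by (simp add: K_def power_divide power_mult_distrib flip: power_mult)
    finally show "(hs_norm 1 b)\<^sup>2 \<le> (K * \<delta>)\<^sup>2" .
  qed (use K \<delta> in simp)
  have b_half: "hs_norm (1/2) b \<le> K * \<delta>"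
    using hs_norm_mono[OF b, of "1/2"] b_le by simp
  \<comment> \<open>Since the ground state has the value \<open>1 - p\<^sup>2\<close> at index 0,
    this multiple agrees with the solution there.\<close>
  define c where "c = ?x 0 / of_real (1 - p\<^sup>2)"
  have nz: "1 - p\<^sup>2 \<noteq> 0" using p by (simp add: power2_eq_1_iff)
  have x_eq: "?x n = b n + c * ?A n" for n
  proof -
    have "(of_real (1 - p\<^sup>2) :: complex) \<noteq> 0" using nz by (simp only: of_real_eq_0_iff not_False_eq_True)
    then have "c * ?A n = ?x 0 * of_real p ^ n"
      unfolding c_def ground_state_def of_real_mult of_real_power by (simp del: of_real_diff)
    then show ?thesis by (simp add: b_def)
  qed
  have cA: "(\<lambda>n. c * ?A n) \<in> hs_space 1" by (rule hs_norm_cmult(1)[OF A])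
  have half: "y \<in> hs_space 1 \<Longrightarrow> y \<in> hs_space (1/2)" for y by (rule hs_space_mono) auto
  have cA_half: "hs_norm (1/2) (\<lambda>n. c * ?A n) = cmod c"
    using hs_norm_cmult(2)[OF half[OF A]] hs_norm_half_ground_state[OF p] by simp
  have x_half: "hs_norm (1/2) ?x = hs_norm (1/2) a"
    using hs_norm_half_conserved[OF sol t] hs_norm_nonneg[OF half[OF x]] hs_norm_nonneg[OF half[OF a(1)]]
    by (simp add: \<alpha>0)
  have d_half: "hs_norm (1/2) d \<le> \<delta>" using hs_norm_mono[OF d, of "1/2"] d_le by simp
  \<comment> \<open>Two inequalities place \<open>cmod c\<close> within \<open>K * \<delta>\<close>
    of the norm of \<open>?x\<close>, and two place the norm of \<open>a\<close> within \<delta> of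
    1; the norms of \<open>?x\<close> and \<open>a\<close> coincide.\<close>
  have "hs_norm (1/2) ?x \<le> hs_norm (1/2) b + hs_norm (1/2) (\<lambda>n. c * ?A n)"
    by (rule hs_triangle(2)[OF half[OF b] half[OF cA]]) (simp only: x_eq norm_triangle_ineq)
  moreover have "hs_norm (1/2) (\<lambda>n. c * ?A n) \<le> hs_norm (1/2) ?x + hs_norm (1/2) b"
  proof (rule hs_triangle(2)[OF half[OF x] half[OF b]])
    show "cmod (c * ?A n) \<le> cmod (?x n) + cmod (b n)" for n
      using norm_triangle_ineq4[of "?x n" "b n"] by (simp add: x_eq)
  qed
  moreover have "hs_norm (1/2) a \<le> hs_norm (1/2) d + hs_norm (1/2) ?A"
  proof (rule hs_triangle(2)[OF half[OF d] half[OF A]])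
    show "cmod (a n) \<le> cmod (d n) + cmod (?A n)" for n
      using norm_triangle_ineq[of "d n" "?A n"] by (simp add: d_def)
  qed
  moreover have "hs_norm (1/2) ?A \<le> hs_norm (1/2) a + hs_norm (1/2) d"
  proof (rule hs_triangle(2)[OF half[OF a(1)] half[OF d]])
    show "cmod (?A n) \<le> cmod (a n) + cmod (d n)" for n
      using norm_triangle_ineq4[of "a n" "d n"] by (simp add: d_def)
  qed
  ultimately have c_near: "\<bar>cmod c - 1\<bar> \<le> (1 + K) * \<delta>"
    using x_half cA_half hs_norm_half_ground_state[OF p] d_half b_half
    by (simp add: algebra_simps abs_le_iff)
  define \<theta> where "\<theta> = Arg c"
  define e where "e = exp (\<i> * of_real \<theta>)"
  have c_eq: "c = of_real (cmod c) * e"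
    unfolding e_def \<theta>_def by (cases "c = 0") (auto simp: Arg_eq)
  have e: "cmod e = 1" by (simp add: e_def)
  have ce: "cmod (c - e) = \<bar>cmod c - 1\<bar>"
  proof -
    have "c - e = of_real (cmod c - 1) * e" by (subst c_eq) (simp add: algebra_simps)
    then have "cmod (c - e) = cmod (of_real (cmod c - 1)) * cmod e" by (simp only: norm_mult)
    then show ?thesis unfolding norm_of_real e by simp
  qed
  have "hs_norm 1 (\<lambda>n. ?x n - e * ?A n) \<le> hs_norm 1 b + hs_norm 1 (\<lambda>n. (c - e) * ?A n)"
  proof (rule hs_triangle(2)[OF b hs_norm_cmult(1)[OF A]])
    show "cmod (?x n - e * ?A n) \<le> cmod (b n) + cmod ((c - e) * ?A n)" for n
      using norm_triangle_ineq[of "b n" "(c - e) * ?A n"] by (simp add: x_eq algebra_simps)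
  qed
  also have "\<dots> = hs_norm 1 b + \<bar>cmod c - 1\<bar> * hs_norm 1 ?A"
    by (simp add: hs_norm_cmult(2)[OF A] ce)
  also have "\<dots> \<le> K * \<delta> + (1 + K) * \<delta> * hs_norm 1 ?A"
    by (intro add_mono b_le mult_right_mono c_near hs_norm_nonneg A)
  also have "\<dots> = (K + (1 + K) * hs_norm 1 ?A) * \<delta>" by (simp add: algebra_simps)
  finally show ?thesis unfolding e_def by blast
qed

theorem theorem4:
  "\<exists>C>0. \<forall>p0\<in>{0<..<1}. \<exists>\<epsilon>0>0. \<forall>\<epsilon>\<in>{0<..<\<epsilon>0}. \<exists>\<delta>>0.
     \<forall>a\<in>hs_space 1. hs_norm 1 (\<lambda>n. a n - ground_state p0 n) \<le> \<delta> \<longrightarrow>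
       (\<forall>\<alpha>. conformal_flow_solution a \<alpha> \<longrightarrow>
         (\<exists>p :: real \<Rightarrow> real. continuous_on {0..} p \<and> (\<forall>t\<ge>0. p t \<in> {0..p0}) \<and>
           (\<forall>t\<ge>0. hs_dist (1/2) (\<alpha> t) (ground_state_orbit (p t)) \<le> \<epsilon> \<and>
                  hs_dist 1 (\<alpha> t) (ground_state_orbit (p t)) \<le> C * (\<epsilon> + sqrt (p0 - p t)))))"
\<comment> \<open>Both \<open>C\<close> and \<open>\<epsilon>0\<close> are taken to be 1: with
  \<open>p t = p0\<close> the square root vanishes and each bound reduces to \<epsilon>.\<close>
proof (rule exI[of _ 1], intro conjI ballI zero_less_one, rule exI[of _ 1], intro conjI ballI zero_less_one)
  fix p0 \<epsilon> :: real
  assume p0: "p0 \<in> {0<..<1}" and \<epsilon>: "\<epsilon> \<in> {0<..<1}"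
  then have p: "0 < p0" "p0 < 1" and \<epsilon>0: "0 < \<epsilon>" by auto
  define K where "K = 6 / (1 - p0)\<^sup>2"
  define B where "B = K + (1 + K) * hs_norm 1 (ground_state p0)"
  have "K > 0" using p by (simp add: K_def)
  then have B: "B > 0"
    unfolding B_def by (intro add_pos_nonneg mult_nonneg_nonneg hs_norm_nonneg ground_state_hs_space p) auto
  show "\<exists>\<delta>>0. \<forall>a\<in>hs_space 1. hs_norm 1 (\<lambda>n. a n - ground_state p0 n) \<le> \<delta> \<longrightarrow>
       (\<forall>\<alpha>. conformal_flow_solution a \<alpha> \<longrightarrow>
         (\<exists>p :: real \<Rightarrow> real. continuous_on {0..} p \<and> (\<forall>t\<ge>0. p t \<in> {0..p0}) \<and>
           (\<forall>t\<ge>0. hs_dist (1/2) (\<alpha> t) (ground_state_orbit (p t)) \<le> \<epsilon> \<and>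
                  hs_dist 1 (\<alpha> t) (ground_state_orbit (p t)) \<le> 1 * (\<epsilon> + sqrt (p0 - p t)))))"
  \<comment> \<open>The stability estimate is linear with factor \<open>B\<close>, which dictates
    this radius.\<close>
  proof (intro exI[of _ "\<epsilon> / B"] conjI ballI impI allI)
    show "0 < \<epsilon> / B" using \<epsilon>0 B by simp
    fix a \<alpha>
    assume a: "a \<in> hs_space 1" "hs_norm 1 (\<lambda>n. a n - ground_state p0 n) \<le> \<epsilon> / B"
      and sol: "conformal_flow_solution a \<alpha>"
    have dist: "hs_dist s (\<alpha> t) (ground_state_orbit p0) \<le> \<epsilon>" if t: "t \<ge> 0" and s: "s \<le> 1" for t s
    proof -
      obtain \<theta> where "hs_norm 1 (\<lambda>n. \<alpha> t n - exp (\<i> * of_real \<theta>) * ground_state p0 n) \<le> B * (\<epsilon> / B)"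
        using ground_state_orbitally_stable[OF p a sol t] unfolding B_def K_def by blast
      with hs_dist_orbit_le[OF conformal_flow_hs_space[OF sol t] s p, of \<theta>] B
      show ?thesis by simp
    qed
    show "\<exists>p :: real \<Rightarrow> real. continuous_on {0..} p \<and> (\<forall>t\<ge>0. p t \<in> {0..p0}) \<and>
           (\<forall>t\<ge>0. hs_dist (1/2) (\<alpha> t) (ground_state_orbit (p t)) \<le> \<epsilon> \<and>
                  hs_dist 1 (\<alpha> t) (ground_state_orbit (p t)) \<le> 1 * (\<epsilon> + sqrt (p0 - p t)))"
      using dist p by (intro exI[of _ "\<lambda>_. p0"]) auto
  qed
qed

end
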